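(* Let $G$ be a nilpotent group equipped with a generating $k$-tuple $S=(s_1,\dots,s_k)$, and let $a=(\alpha_1,\dots,\alpha_k)\in(0,\infty]^k$. If there exists $i\in\{1,\dots,k\}$ such that $(\alpha_i,\ell(s_i))=(2,1)$ or $\alpha_i\,\ell(s_i)<2$, then $$\lim_{n\to\infty}\left[n^{D(G)/2}\mu_{S,a}^{(n)}(e)\right]=0.$$
   Context: $e$ is the identity of $G$; repetitions are allowed in $S$. The probability measure $\mu_{S,a}$ on $G$ is $$\mu_{S,a}(g)=\frac1k\sum_{i=1}^k c(\alpha_i)\sum_{m\in\mathbb Z}(1+|m|)^{-\alpha_i-1}\mathbf 1_{s_i^m}(g),\qquad c(\alpha)^{-1}=\sum_{m\in\mathbb Z}(1+|m|)^{-\alpha-1},$$ with the convention that for $\alpha=\infty$ the quantity $(1+|m|)^{-\alpha-1}$ equals $1$ if $m\in\{0,\pm1\}$ and $0$ otherwise. $\mu^{(n)}$ is the $n$-fold convolution power. $G_1=G$, $G_j=[G,G_{j-1}]$ is the lower central series, and $D(G)=\sum_{j\ge1}j\,\mathrm{rank}(G_j/G_{j+1})$ (torsion-free rank). The commutator length $\ell(g)\in\{1,2,\dots\}\cup\{\infty\}$ of $g\in G$ is the supremum of the integers $\ell$ such that $g^m\in G_\ell$ for some integer $m\ge1$; torsion elements have $\ell(g)=\infty$. *)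

theory Defs
  imports "HOL-Analysis.Analysis" "HOL-Algebra.Generated_Groups" "HOL-Algebra.FiniteProduct"
begin

definition commutator_subgroup ::
    "('a, 'b) monoid_scheme \<Rightarrow> 'a set \<Rightarrow> 'a set \<Rightarrow> 'a set" where
  "commutator_subgroup G H K =
     generate G {h \<otimes>\<^bsub>G\<^esub> k \<otimes>\<^bsub>G\<^esub> inv\<^bsub>G\<^esub> h \<otimes>\<^bsub>G\<^esub> inv\<^bsub>G\<^esub> k | h k. h \<in> H \<and> k \<in> K}"

(* Indexed from 1: lower_central G 1 = G.  The value at 0 is never used. *)
fun lower_central :: "('a, 'b) monoid_scheme \<Rightarrow> nat \<Rightarrow> 'a set" where
  "lower_central G 0 = carrier G"
| "lower_central G (Suc 0) = carrier G"
| "lower_central G (Suc (Suc j)) =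
     commutator_subgroup G (carrier G) (lower_central G (Suc j))"

locale nilpotent_group = group G for G (structure) +
  assumes nilpotent: "\<exists>j\<ge>1. lower_central G j = {\<one>}"

definition int_independent :: "('a, 'b) monoid_scheme \<Rightarrow> 'a set \<Rightarrow> bool" where
  "int_independent A B \<longleftrightarrow>
     (\<forall>c :: 'a \<Rightarrow> int. finprod A (\<lambda>b. b [^]\<^bsub>A\<^esub> c b) B = \<one>\<^bsub>A\<^esub> \<longrightarrow> (\<forall>b\<in>B. c b = 0))"

(* For abelian A: the maximal number of independent elements, i.e. dim_Q (A \<otimes> Q).
   Only meaningful when it is finite, e.g. when A is finitely generated. *)
definition torsion_free_rank :: "('a, 'b) monoid_scheme \<Rightarrow> nat" where
  "torsion_free_rank A = Sup {card B | B. finite B \<and> B \<subseteq> carrier A \<and> int_independent A B}"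

definition lower_central_quotient :: "('a, 'b) monoid_scheme \<Rightarrow> nat \<Rightarrow> 'a set monoid" where
  "lower_central_quotient G j =
     (G\<lparr>carrier := lower_central G j\<rparr>) Mod (lower_central G (Suc j))"

(* The sum over all j \<ge> 1 is a sum over its support, which is finite for nilpotent G. *)
definition homogeneous_dim :: "('a, 'b) monoid_scheme \<Rightarrow> nat" where
  "homogeneous_dim G =
     (\<Sum>j | 1 \<le> j \<and> torsion_free_rank (lower_central_quotient G j) \<noteq> 0.
        j * torsion_free_rank (lower_central_quotient G j))"

definition commutator_length :: "('a, 'b) monoid_scheme \<Rightarrow> 'a \<Rightarrow> enat" where
  "commutator_length G g =
     Sup {enat l | l. 1 \<le> l \<and> (\<exists>m::nat. 1 \<le> m \<and> g [^]\<^bsub>G\<^esub> m \<in> lower_central G l)}"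

definition stable_weight :: "ereal \<Rightarrow> int \<Rightarrow> real" where
  "stable_weight \<alpha> m =
     (if \<alpha> = \<infinity> then (if m \<in> {-1, 0, 1} then 1 else 0)
      else (1 + \<bar>real_of_int m\<bar>) powr (- real_of_ereal \<alpha> - 1))"

definition stable_const :: "ereal \<Rightarrow> real" where
  "stable_const \<alpha> = inverse (\<Sum>\<^sub>\<infinity>m\<in>UNIV. stable_weight \<alpha> m)"

definition stable_walk_measure ::
    "('a, 'b) monoid_scheme \<Rightarrow> nat \<Rightarrow> (nat \<Rightarrow> 'a) \<Rightarrow> (nat \<Rightarrow> ereal) \<Rightarrow> 'a \<Rightarrow> real" where
  "stable_walk_measure G k s \<alpha> g =
     1 / real k * (\<Sum>i=1..k. stable_const (\<alpha> i) *
       (\<Sum>\<^sub>\<infinity>m::int\<in>UNIV. stable_weight (\<alpha> i) m * indicator {s i [^]\<^bsub>G\<^esub> m} g))"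

definition group_convolution ::
    "('a, 'b) monoid_scheme \<Rightarrow> ('a \<Rightarrow> real) \<Rightarrow> ('a \<Rightarrow> real) \<Rightarrow> 'a \<Rightarrow> real" where
  "group_convolution G u v x = (\<Sum>\<^sub>\<infinity>y\<in>carrier G. u y * v (inv\<^bsub>G\<^esub> y \<otimes>\<^bsub>G\<^esub> x))"

primrec convolution_power ::
    "('a, 'b) monoid_scheme \<Rightarrow> ('a \<Rightarrow> real) \<Rightarrow> nat \<Rightarrow> 'a \<Rightarrow> real" where
  "convolution_power G u 0 = indicator {\<one>\<^bsub>G\<^esub>}"
| "convolution_power G u (Suc n) = group_convolution G u (convolution_power G u n)"

end

theory Submission
  imports Defs
begin

text \<open>Write \<open>u\<^sub>n\<close> for the \<open>n\<close>-fold convolution power of the step distribution \<open>\<mu>\<close>, \<open>a\<^sub>n\<close> for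
\<open>u\<^sub>2\<^sub>n(e)\<close> and \<open>D\<close> for the homogeneous dimension. Since \<open>u\<^sub>n\<close> is symmetric, the deficit
\<open>d\<^sub>n(g) = a\<^sub>n - u\<^sub>2\<^sub>n(g)\<close> equals half of the squared \<open>l\<^sup>2\<close> distance between \<open>u\<^sub>n\<close> and its
translate by \<open>g\<close>. Two things follow. By Minkowski's inequality the square root of \<open>d\<^sub>n\<close> is
subadditive on the group; and because \<open>\<mu>\<close> charges the identity, the energy
\<open>E\<^sub>n = a\<^sub>n - a\<^sub>n\<^sub>+\<^sub>1\<close> dominates a constant times \<open>\<Sum>g. \<mu>(g) d\<^sub>n(g)\<close>.

Consider the length \<open>len g\<close>, the best constant with \<open>d\<^sub>n(g) \<le> (len g)\<^sup>2 E\<^sub>n\<close> for all \<open>n\<close>. It is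
finite and subadditive. Averaging \<open>d\<^sub>n(g) = a\<^sub>n - u\<^sub>2\<^sub>n(g)\<close> over a finite set \<open>A\<close> of elements of
length at most \<open>r\<close> gives the Nash-type inequality \<open>a\<^sub>n \<le> 1/|A| + r\<^sup>2 (a\<^sub>n - a\<^sub>n\<^sub>+\<^sub>1)\<close>
(\<open>return_prob_le_volume\<close>). Summed over \<open>n, ..., 2n - 1\<close> with \<open>r\<^sup>2\<close> a small multiple of \<open>n\<close>,
it shows that \<open>n\<close> to the power \<open>D/2\<close> times \<open>a\<^sub>n\<close> tends to 0 as soon as balls of radius \<open>R\<close> for
\<open>len\<close> contain more than \<open>K R\<^sup>D\<close> elements for every \<open>K\<close> and all large \<open>R\<close> (\<open>nash_decay\<close>).

The required volume comes from the lower central series. Layer \<open>j\<close>, the quotient of \<open>G\<^sub>j\<close> by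
\<open>G\<^sub>j\<^sub>+\<^sub>1\<close>, has rank \<open>r\<^sub>j\<close>. Bilinearity of the commutator modulo the next term shows that, for \<open>x\<close>
in \<open>G\<^sub>j\<close> and \<open>|m| \<le> R\<^sup>j\<close>, the class of \<open>x\<^sup>m\<close> in layer \<open>j\<close> has a representative of length \<open>O(R)\<close>
(\<open>short_powers_lower_central\<close>). So about \<open>R\<close> to the power \<open>j r\<^sub>j\<close> classes of layer \<open>j\<close> are
represented in a ball of radius \<open>O(R)\<close>, and multiplying representatives of all layers produces
\<open>R\<^sup>D\<close> distinct elements. The hypothesis on \<open>s\<^sub>i\<close> supplies the additional factor \<open>K\<close>: the heavy
tail of \<open>\<mu>\<close> along the powers of \<open>s\<^sub>i\<close> makes \<open>s\<^sub>i\<^sup>m\<close> short, of length \<open>O(R)\<close> for all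
\<open>m \<le> K R\<^sup>l\<close> with \<open>l\<close> the commutator length of \<open>s\<^sub>i\<close> (\<open>superlinear_powers\<close>). As some power of \<open>s\<^sub>i\<close>
represents an element of infinite order in layer \<open>l\<close>, it can be exchanged into a maximal independent
set of that layer, which gains the factor \<open>K\<close> (\<open>volume_lower_bound\<close>).\<close>

section \<open>Convolution of probability densities on a group\<close>

definition prob_density :: "('a, 'b) monoid_scheme \<Rightarrow> ('a \<Rightarrow> real) \<Rightarrow> bool" where
  "prob_density G f \<longleftrightarrow> (\<forall>x\<in>carrier G. 0 \<le> f x) \<and> (f has_sum 1) (carrier G)"

context group
begin

lemma mult_inv_cancel_left [simp]:
  assumes "x \<in> carrier G" "y \<in> carrier G"
  shows "y \<otimes> (inv y \<otimes> x) = x" and "inv y \<otimes> (y \<otimes> x) = x"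
  using assms by (simp_all add: m_assoc[symmetric])

lemma bij_betw_translation:
  assumes "y \<in> carrier G"
  shows "bij_betw (\<lambda>x. inv y \<otimes> x) (carrier G) (carrier G)"
  by (rule bij_betwI[of _ _ _ "\<lambda>x. y \<otimes> x"]) (use assms in \<open>auto simp: m_assoc[symmetric]\<close>)

lemma prob_density_le_1:
  assumes "prob_density G f" "x \<in> carrier G"
  shows "f x \<le> 1"
proof -
  have "sum f {x} \<le> 1"
    by (rule finite_sum_le_has_sum[of f "carrier G" 1]) (use assms in \<open>auto simp: prob_density_def\<close>)
  then show ?thesis by simp
qed

text \<open>Fubini's theorem for convolutions rests on this one joint sum over pairs: the
interchanges of sums below are justified by it or by comparison with it.\<close>

lemma has_sum_convolution_pairs:
  assumes f: "prob_density G f" and g: "prob_density G g"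
  shows "((\<lambda>(y,x). f y * g (inv y \<otimes> x)) has_sum 1) (carrier G \<times> carrier G)"
proof (rule has_sum_SigmaI)
  have "(f has_sum 1) (carrier G)" using f by (simp add: prob_density_def)
  then show fs: "(f has_sum 1) (carrier G)" .
  show inner: "((\<lambda>x. case (y, x) of (y, x) \<Rightarrow> f y * g (inv y \<otimes> x)) has_sum f y) (carrier G)"
    if "y \<in> carrier G" for y
  proof -
    have "((\<lambda>x. g (inv y \<otimes> x)) has_sum 1) (carrier G)"
      using has_sum_reindex_bij_betw[OF bij_betw_translation[OF that], where f = g and S = 1] g
      by (simp add: prob_density_def)
    then show ?thesis using has_sum_cmult_right[of "\<lambda>x. g (inv y \<otimes> x)" _ 1 "f y"] by simp
  qed
  show "(\<lambda>(y,x). f y * g (inv y \<otimes> x)) summable_on carrier G \<times> carrier G"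
    by (rule summable_on_SigmaI[OF inner]) 
       (use f g fs in \<open>auto simp: prob_density_def has_sum_imp_summable\<close>)
qed

lemma prob_density_convolution:
  assumes f: "prob_density G f" and g: "prob_density G g"
  shows "prob_density G (group_convolution G f g)"
proof -
  have swapped: "((\<lambda>(x,y). f y * g (inv y \<otimes> x)) has_sum 1) (carrier G \<times> carrier G)"
    using has_sum_swap[THEN iffD1, OF has_sum_convolution_pairs[OF f g]]
    by (simp add: case_prod_unfold)
  then have "(\<lambda>(x,y). f y * g (inv y \<otimes> x)) summable_on (carrier G \<times> carrier G)"
    by (rule has_sum_imp_summable)
  then have "(\<lambda>y. f y * g (inv y \<otimes> x)) summable_on carrier G" if "x \<in> carrier G" for x
    using that by (rule summable_on_SigmaD1)
  then have "((\<lambda>x. \<Sum>\<^sub>\<infinity>y\<in>carrier G. f y * g (inv y \<otimes> x)) has_sum 1) (carrier G)"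
    by (intro has_sum_SigmaD[OF swapped]) auto
  moreover have "0 \<le> group_convolution G f g x" if "x \<in> carrier G" for x
    using f g that by (auto simp: group_convolution_def prob_density_def intro!: infsum_nonneg)
  ultimately show ?thesis
    unfolding prob_density_def group_convolution_def by auto
qed

lemma summable_on_convolution:
  assumes f: "prob_density G f" and g: "prob_density G g" and x: "x \<in> carrier G"
  shows "(\<lambda>y. f y * g (inv y \<otimes> x)) summable_on carrier G"
proof (rule summable_on_comparison_test[of f])
  show "f summable_on carrier G" using f by (auto simp: prob_density_def has_sum_imp_summable)
  fix y assume y: "y \<in> carrier G"
  have "g (inv y \<otimes> x) \<le> 1" using prob_density_le_1[OF g] x y by auto
  then show "f y * g (inv y \<otimes> x) \<le> f y"
    using f y by (auto simp: prob_density_def intro!: mult_left_le)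
  show "0 \<le> f y * g (inv y \<otimes> x)" using f g x y by (auto simp: prob_density_def)
qed

lemma group_convolution_assoc:
  assumes f: "prob_density G f" and g: "prob_density G g" and k: "prob_density G k"
    and x: "x \<in> carrier G"
  shows "group_convolution G (group_convolution G f g) k x =
         group_convolution G f (group_convolution G g k) x"
proof -
  have "(\<lambda>(y,z). f y * g (inv y \<otimes> z)) summable_on (carrier G \<times> carrier G)"
    using has_sum_convolution_pairs[OF f g] by (rule has_sum_imp_summable)
  then have summ: "(\<lambda>(y,z). f y * g (inv y \<otimes> z) * k (inv z \<otimes> x)) summable_on (carrier G \<times> carrier G)"
  proof (rule summable_on_comparison_test, goal_cases)
    case (1 p) then show ?case
      using prob_density_le_1[OF k, of "inv (snd p) \<otimes> x"] f g x
      by (auto simp: prob_density_def intro!: mult_left_le)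
  next
    case (2 p) then show ?case using f g k x by (auto simp: prob_density_def)
  qed
  have "group_convolution G (group_convolution G f g) k x =
      (\<Sum>\<^sub>\<infinity>z\<in>carrier G. \<Sum>\<^sub>\<infinity>y\<in>carrier G. f y * g (inv y \<otimes> z) * k (inv z \<otimes> x))"
    unfolding group_convolution_def by (simp add: infsum_cmult_left')
  also have "\<dots> = (\<Sum>\<^sub>\<infinity>y\<in>carrier G. \<Sum>\<^sub>\<infinity>z\<in>carrier G. f y * g (inv y \<otimes> z) * k (inv z \<otimes> x))"
    using summ by (subst infsum_swap_banach) auto
  also have "\<dots> = (\<Sum>\<^sub>\<infinity>y\<in>carrier G. f y * (\<Sum>\<^sub>\<infinity>z\<in>carrier G. g (inv y \<otimes> z) * k (inv z \<otimes> x)))"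
    by (simp add: infsum_cmult_right' mult.assoc)
  also have "\<dots> = (\<Sum>\<^sub>\<infinity>y\<in>carrier G. f y * (\<Sum>\<^sub>\<infinity>w\<in>carrier G. g w * k (inv w \<otimes> (inv y \<otimes> x))))"
  proof (rule infsum_cong)
    fix y assume y: "y \<in> carrier G"
    have "(\<Sum>\<^sub>\<infinity>w\<in>carrier G. g w * k (inv w \<otimes> (inv y \<otimes> x))) =
        (\<Sum>\<^sub>\<infinity>z\<in>carrier G. g (inv y \<otimes> z) * k (inv (inv y \<otimes> z) \<otimes> (inv y \<otimes> x)))"
      by (rule infsum_reindex_bij_betw[OF bij_betw_translation[OF y], symmetric])
    also have "\<dots> = (\<Sum>\<^sub>\<infinity>z\<in>carrier G. g (inv y \<otimes> z) * k (inv z \<otimes> x))"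
    proof (rule infsum_cong)
      fix z assume z: "z \<in> carrier G"
      have "inv (inv y \<otimes> z) \<otimes> (inv y \<otimes> x) = inv z \<otimes> x"
        using x y z by (simp add: inv_mult_group m_assoc)
      then show "g (inv y \<otimes> z) * k (inv (inv y \<otimes> z) \<otimes> (inv y \<otimes> x)) =
        g (inv y \<otimes> z) * k (inv z \<otimes> x)" by simp
    qed
    finally show "f y * (\<Sum>\<^sub>\<infinity>z\<in>carrier G. g (inv y \<otimes> z) * k (inv z \<otimes> x)) =
      f y * (\<Sum>\<^sub>\<infinity>w\<in>carrier G. g w * k (inv w \<otimes> (inv y \<otimes> x)))" by simp
  qed
  finally show ?thesis unfolding group_convolution_def .
qed

lemma prob_density_point_mass: "prob_density G (indicator {\<one>})"
proof -
  have "((indicator {\<one>} :: 'a \<Rightarrow> real) has_sum 1) {\<one>}"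
    by (rule has_sum_finiteI) auto
  moreover have "((indicator {\<one>} :: 'a \<Rightarrow> real) has_sum 1) {\<one>} =
      ((indicator {\<one>} :: 'a \<Rightarrow> real) has_sum 1) (carrier G)"
    by (rule has_sum_cong_neutral) auto
  ultimately show ?thesis
    by (auto simp: prob_density_def)
qed

lemma group_convolution_point_mass_left:
  assumes x: "x \<in> carrier G"
  shows "group_convolution G (indicator {\<one>}) f x = f x"
proof -
  have "group_convolution G (indicator {\<one>}) f x =
      (\<Sum>\<^sub>\<infinity>y\<in>{\<one>}. indicator {\<one>} y * f (inv y \<otimes> x))"
    unfolding group_convolution_def by (rule infsum_cong_neutral) auto
  then show ?thesis using x by simp
qed

lemma group_convolution_point_mass_right:
  assumes x: "x \<in> carrier G"
  shows "group_convolution G f (indicator {\<one>}) x = f x"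
proof -
  have *: "inv y \<otimes> x = \<one> \<longleftrightarrow> y = x" if y: "y \<in> carrier G" for y
    using mult_inv_cancel_left(1)[OF x y] x y by (metis r_one l_inv)
  have "group_convolution G f (indicator {\<one>}) x =
      (\<Sum>\<^sub>\<infinity>y\<in>{x}. f y * indicator {\<one>} (inv y \<otimes> x))"
    unfolding group_convolution_def by (rule infsum_cong_neutral) (use x in \<open>auto simp: *\<close>)
  then show ?thesis using x by simp
qed

lemma group_convolution_cong:
  assumes "\<And>y. y \<in> carrier G \<Longrightarrow> f y = f' y" "\<And>y. y \<in> carrier G \<Longrightarrow> g y = g' y"
    "x \<in> carrier G"
  shows "group_convolution G f g x = group_convolution G f' g' x"
  unfolding group_convolution_def by (rule infsum_cong) (use assms in auto)

end

section \<open>Return probabilities of symmetric random walks\<close>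

locale symmetric_walk = group G for G :: "('a, 'b) monoid_scheme" (structure) +
  fixes \<mu> :: "'a \<Rightarrow> real"
  assumes density: "prob_density G \<mu>"
    and symmetric: "x \<in> carrier G \<Longrightarrow> \<mu> (inv x) = \<mu> x"
    and lazy: "0 < \<mu> \<one>"
begin

abbreviation walk :: "nat \<Rightarrow> 'a \<Rightarrow> real" where
  "walk \<equiv> convolution_power G \<mu>"

lemma density_walk: "prob_density G (walk n)"
  by (induction n) (auto simp: prob_density_point_mass density intro: prob_density_convolution)

lemma walk_nonneg: "x \<in> carrier G \<Longrightarrow> 0 \<le> walk n x"
  using density_walk[of n] by (simp add: prob_density_def)

lemma walk_add:
  "x \<in> carrier G \<Longrightarrow> walk (m + n) x = group_convolution G (walk m) (walk n) x"
proof (induction m arbitrary: x)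
  case 0
  then show ?case by (simp add: group_convolution_point_mass_left)
next
  case (Suc m)
  have "walk (Suc m + n) x = group_convolution G \<mu> (group_convolution G (walk m) (walk n)) x"
    by (simp, rule group_convolution_cong) (simp_all add: Suc)
  then show ?case using Suc.prems by (simp add: group_convolution_assoc density density_walk)
qed

text \<open>The step distribution can be peeled off on the left or on the right of a convolution power, and
inversion exchanges the two descriptions.\<close>

lemma walk_inv: "x \<in> carrier G \<Longrightarrow> walk n (inv x) = walk n x"
proof (induction n arbitrary: x)
  case 0
  then show ?case by (auto simp: indicator_def)
next
  case (Suc n)
  have one: "walk 1 y = \<mu> y" if "y \<in> carrier G" for y
    using that by (simp add: group_convolution_point_mass_right)
  have "walk (Suc n) (inv x) = (\<Sum>\<^sub>\<infinity>y\<in>carrier G. \<mu> y * walk n (inv y \<otimes> inv x))"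
    by (simp add: group_convolution_def)
  also have "\<dots> = (\<Sum>\<^sub>\<infinity>y\<in>carrier G. \<mu> (inv x \<otimes> y) * walk n (inv (inv x \<otimes> y) \<otimes> inv x))"
    by (rule infsum_reindex_bij_betw[OF bij_betw_translation[OF Suc.prems], symmetric])
  also have "\<dots> = (\<Sum>\<^sub>\<infinity>y\<in>carrier G. walk n y * walk 1 (inv y \<otimes> x))"
  proof (rule infsum_cong)
    fix y assume y: "y \<in> carrier G"
    have "inv (inv x \<otimes> y) \<otimes> inv x = inv y"
      using Suc.prems y by (simp add: inv_mult_group m_assoc)
    moreover have "\<mu> (inv x \<otimes> y) = walk 1 (inv y \<otimes> x)"
      using symmetric[of "inv y \<otimes> x"] Suc.prems y by (simp add: one inv_mult_group del: One_nat_def)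
    ultimately show "\<mu> (inv x \<otimes> y) * walk n (inv (inv x \<otimes> y) \<otimes> inv x) = walk n y * walk 1 (inv y \<otimes> x)"
      using Suc.IH[OF y] by (simp del: One_nat_def)
  qed
  also have "\<dots> = walk (Suc n) x" using walk_add[of x n 1] Suc.prems by (simp add: group_convolution_def)
  finally show ?case .
qed

text \<open>Even times matter because \<open>walk (2 * n)\<close> is the autocorrelation of \<open>walk n\<close>, hence positive definite.\<close>

definition return_prob :: "nat \<Rightarrow> real" where "return_prob n = walk (2 * n) \<one>"

definition deficit :: "nat \<Rightarrow> 'a \<Rightarrow> real" where "deficit n g = return_prob n - walk (2 * n) g"

lemma summable_walk_products:
  assumes g: "g \<in> carrier G"
  shows "(\<lambda>x. walk n x * walk n (inv g \<otimes> x)) summable_on carrier G"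
    and "(\<Sum>\<^sub>\<infinity>x\<in>carrier G. walk n x * walk n (inv g \<otimes> x)) = walk (2 * n) g"
proof -
  have *: "walk n x * walk n (inv g \<otimes> x) = walk n x * walk n (inv x \<otimes> g)" if "x \<in> carrier G" for x
    using walk_inv[of "inv g \<otimes> x" n] g that by (simp add: inv_mult_group)
  show "(\<lambda>x. walk n x * walk n (inv g \<otimes> x)) summable_on carrier G"
    using summable_on_convolution[OF density_walk density_walk g, of n n]
    by (simp add: summable_on_cong[OF *])
  show "(\<Sum>\<^sub>\<infinity>x\<in>carrier G. walk n x * walk n (inv g \<otimes> x)) = walk (2 * n) g"
    using walk_add[OF g, of n n] 
    by (simp add: infsum_cong[OF *] group_convolution_def mult_2)
qed

text \<open>
Expanding the square leaves two equal squared norms, each the return probability, and the cross term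
\<open>walk (2 * n) h\<close>. The additional translation by \<open>g\<close> is what the triangle inequality needs.
\<close>

lemma has_sum_deficit:
  assumes g: "g \<in> carrier G" and h: "h \<in> carrier G"
  shows "((\<lambda>x. (walk n (inv g \<otimes> x) - walk n (inv (g \<otimes> h) \<otimes> x))\<^sup>2) has_sum (2 * deficit n h)) (carrier G)"
proof -
  define a where "a = walk n"
  have sq: "((\<lambda>x. a x * a x) has_sum return_prob n) (carrier G)"
    using summable_walk_products[of \<one> n] 
    by (auto simp: has_sum_iff return_prob_def a_def cong: infsum_cong summable_on_cong)
  have "((\<lambda>x. a (inv h \<otimes> x) * a (inv h \<otimes> x)) has_sum return_prob n) (carrier G)"
    using has_sum_reindex_bij_betw[OF bij_betw_translation[OF h], where f = "\<lambda>x. a x * a x" and S = "return_prob n"] sq by simp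
  moreover have "((\<lambda>x. a x * a (inv h \<otimes> x)) has_sum walk (2 * n) h) (carrier G)"
    using summable_walk_products[OF h] unfolding has_sum_iff a_def by blast
  then have "((\<lambda>x. (- 2) * (a x * a (inv h \<otimes> x))) has_sum (- 2) * walk (2 * n) h) (carrier G)"
    by (rule has_sum_cmult_right)
  ultimately have "((\<lambda>x. (a x * a x + a (inv h \<otimes> x) * a (inv h \<otimes> x)) + (- 2) * (a x * a (inv h \<otimes> x)))
     has_sum ((return_prob n + return_prob n) + (- 2) * walk (2 * n) h)) (carrier G)"
    by (intro has_sum_add sq)
  moreover have "(return_prob n + return_prob n) + (- 2) * walk (2 * n) h = 2 * deficit n h"
    by (simp add: deficit_def)
  ultimately have "((\<lambda>x. (a x - a (inv h \<otimes> x))\<^sup>2) has_sum (2 * deficit n h)) (carrier G)"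
    by (simp add: power2_eq_square algebra_simps)
  then have "((\<lambda>x. (a (inv g \<otimes> x) - a (inv h \<otimes> (inv g \<otimes> x)))\<^sup>2) has_sum (2 * deficit n h)) (carrier G)"
    using has_sum_reindex_bij_betw[OF bij_betw_translation[OF g], where f = "\<lambda>x. (a x - a (inv h \<otimes> x))\<^sup>2" and S = "2 * deficit n h"]
    by simp
  moreover have "inv h \<otimes> (inv g \<otimes> x) = inv (g \<otimes> h) \<otimes> x" if "x \<in> carrier G" for x
    using g h that by (simp add: inv_mult_group m_assoc)
  then have "((\<lambda>x. (a (inv g \<otimes> x) - a (inv h \<otimes> (inv g \<otimes> x)))\<^sup>2) has_sum S) (carrier G) \<longleftrightarrow>
      ((\<lambda>x. (a (inv g \<otimes> x) - a (inv (g \<otimes> h) \<otimes> x))\<^sup>2) has_sum S) (carrier G)" for S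
    by (intro has_sum_cong) simp
  ultimately show ?thesis unfolding a_def by blast
qed

lemma deficit_nonneg: "g \<in> carrier G \<Longrightarrow> 0 \<le> deficit n g"
  using has_sum_nonneg[OF has_sum_deficit[of \<one> g n]] by auto

lemma deficit_inv: "g \<in> carrier G \<Longrightarrow> deficit n (inv g) = deficit n g"
  by (simp add: deficit_def walk_inv)

lemma deficit_one: "deficit n \<one> = 0"
  by (simp add: deficit_def return_prob_def)

text \<open>Minkowski's inequality for \<open>walk n\<close> and its translates by \<open>g\<close> and by \<open>g \<otimes> h\<close>, on finite sets and then in the limit.\<close>

lemma sqrt_deficit_mult:
  assumes g: "g \<in> carrier G" and h: "h \<in> carrier G"
  shows "sqrt (deficit n (g \<otimes> h)) \<le> sqrt (deficit n g) + sqrt (deficit n h)"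
proof -
  define a where "a = (\<lambda>x. walk n (inv \<one> \<otimes> x))"
  define b where "b = (\<lambda>x. walk n (inv g \<otimes> x))"
  define c where "c = (\<lambda>x. walk n (inv (g \<otimes> h) \<otimes> x))"
  have ab: "((\<lambda>x. (a x - b x)\<^sup>2) has_sum (2 * deficit n g)) (carrier G)"
    using has_sum_deficit[of \<one> g n] g by (simp add: a_def b_def)
  have bc: "((\<lambda>x. (b x - c x)\<^sup>2) has_sum (2 * deficit n h)) (carrier G)"
    using has_sum_deficit[of g h n] g h by (simp add: b_def c_def)
  have ac: "((\<lambda>x. (a x - c x)\<^sup>2) has_sum (2 * deficit n (g \<otimes> h))) (carrier G)"
    using has_sum_deficit[of \<one> "g \<otimes> h" n] g h by (simp add: a_def c_def)
  have fin: "L2_set (\<lambda>x. u x) F \<le> sqrt S" 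
    if "((\<lambda>x. (u x)\<^sup>2) has_sum S) (carrier G)" "finite F" "F \<subseteq> carrier G" for u :: "'a \<Rightarrow> real" and S F
    unfolding L2_set_def using finite_sum_le_has_sum[OF that] by simp
  have "2 * deficit n (g \<otimes> h) \<le> (sqrt (2 * deficit n g) + sqrt (2 * deficit n h))\<^sup>2"
  proof (rule has_sum_le_finite_sums[OF ac])
    fix F assume F: "finite F" "F \<subseteq> carrier G"
    have "L2_set (\<lambda>x. a x - c x) F = L2_set (\<lambda>x. (a x - b x) + (b x - c x)) F" by simp
    also have "\<dots> \<le> L2_set (\<lambda>x. a x - b x) F + L2_set (\<lambda>x. b x - c x) F"
      by (rule L2_set_triangle_ineq)
    also have "\<dots> \<le> sqrt (2 * deficit n g) + sqrt (2 * deficit n h)"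
      by (intro add_mono fin ab bc F)
    finally have "(L2_set (\<lambda>x. a x - c x) F)\<^sup>2 \<le> (sqrt (2 * deficit n g) + sqrt (2 * deficit n h))\<^sup>2"
      by (simp add: power_mono L2_set_nonneg)
    then show "(\<Sum>x\<in>F. (a x - c x)\<^sup>2) \<le> (sqrt (2 * deficit n g) + sqrt (2 * deficit n h))\<^sup>2"
      by (simp add: L2_set_def sum_nonneg)
  qed
  then have "sqrt (2 * deficit n (g \<otimes> h)) \<le> sqrt (2 * deficit n g) + sqrt (2 * deficit n h)"
    by (intro real_le_lsqrt) (use g h in \<open>auto intro!: deficit_nonneg add_nonneg_nonneg\<close>)
  then have "sqrt 2 * sqrt (deficit n (g \<otimes> h)) \<le> sqrt 2 * (sqrt (deficit n g) + sqrt (deficit n h))"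
    by (simp add: real_sqrt_mult distrib_left)
  then show ?thesis by simp
qed

lemma walk_even_le: "g \<in> carrier G \<Longrightarrow> walk (2 * n) g \<le> return_prob n"
  using deficit_nonneg[of g n] by (simp add: deficit_def)

lemma has_sum_step:
  assumes v: "prob_density G v" and g: "g \<in> carrier G"
  shows "((\<lambda>y. \<mu> y * (c - v (inv y \<otimes> g))) has_sum (c - group_convolution G \<mu> v g)) (carrier G)"
proof -
  have "((\<lambda>y. c * \<mu> y) has_sum c * 1) (carrier G)"
    by (rule has_sum_cmult_right) (use density in \<open>simp add: prob_density_def\<close>)
  moreover have "((\<lambda>y. \<mu> y * v (inv y \<otimes> g)) has_sum group_convolution G \<mu> v g) (carrier G)"
    using summable_on_convolution[OF density v g] by (simp add: group_convolution_def)
  then have "((\<lambda>y. - (\<mu> y * v (inv y \<otimes> g))) has_sum - group_convolution G \<mu> v g) (carrier G)"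
    by (rule has_sum_uminusI)
  ultimately have "((\<lambda>y. c * \<mu> y + - (\<mu> y * v (inv y \<otimes> g))) has_sum c * 1 + - group_convolution G \<mu> v g) (carrier G)"
    by (rule has_sum_add)
  then show ?thesis by (simp add: algebra_simps)
qed

text \<open>Half a step: among all first steps of the walk, only the one that stays at the identity is kept. The
other terms are nonnegative because \<open>walk (2 * n)\<close> is maximal at the identity.\<close>

lemma walk_odd_deficit:
  assumes g: "g \<in> carrier G"
  shows "\<mu> \<one> * deficit n g \<le> return_prob n - walk (2 * n + 1) g"
proof -
  have "(\<Sum>y\<in>{\<one>}. \<mu> y * (return_prob n - walk (2 * n) (inv y \<otimes> g))) \<le> return_prob n - walk (2 * n + 1) g"
  proof (rule finite_sum_le_has_sum)
    show "((\<lambda>y. \<mu> y * (return_prob n - walk (2 * n) (inv y \<otimes> g))) has_sum return_prob n - walk (2 * n + 1) g) (carrier G)"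
      using has_sum_step[OF density_walk g] by simp
    fix y assume "y \<in> carrier G - {\<one>}"
    then show "0 \<le> \<mu> y * (return_prob n - walk (2 * n) (inv y \<otimes> g))"
      using g density walk_even_le[of "inv y \<otimes> g" n] by (auto simp: prob_density_def)
  qed auto
  then show ?thesis using g by (simp add: deficit_def)
qed

lemma walk_odd_le: "g \<in> carrier G \<Longrightarrow> walk (2 * n + 1) g \<le> return_prob n"
  using walk_odd_deficit[of g n] deficit_nonneg[of g n] lazy
  by (smt (verit) mult_nonneg_nonneg)

text \<open>The loss of return probability in two steps dominates the Dirichlet form of \<open>\<mu>\<close>; the
factor \<open>\<mu> \<one>\<close> is the price for letting one of the two steps be trivial.\<close>

lemma energy_ge:
  assumes F: "finite F" "F \<subseteq> carrier G"
  shows "\<mu> \<one> * (\<Sum>g\<in>F. \<mu> g * deficit n g) \<le> return_prob n - return_prob (Suc n)"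
proof -
  have "(\<Sum>g\<in>F. \<mu> g * (return_prob n - walk (2 * n + 1) (inv g \<otimes> \<one>))) \<le> return_prob n - return_prob (Suc n)"
  proof (rule finite_sum_le_has_sum[OF _ F])
    show "((\<lambda>g. \<mu> g * (return_prob n - walk (2 * n + 1) (inv g \<otimes> \<one>))) has_sum return_prob n - return_prob (Suc n)) (carrier G)"
      using has_sum_step[OF density_walk[of "2 * n + 1"] one_closed] by (simp add: return_prob_def)
    fix y assume "y \<in> carrier G - F"
    then show "0 \<le> \<mu> y * (return_prob n - walk (2 * n + 1) (inv y \<otimes> \<one>))"
      using density walk_odd_le[of "inv y" n] by (auto simp: prob_density_def)
  qed
  moreover have "\<mu> \<one> * (\<mu> g * deficit n g) \<le> \<mu> g * (return_prob n - walk (2 * n + 1) (inv g \<otimes> \<one>))" if "g \<in> F" for g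
  proof -
    have "g \<in> carrier G" using that F by auto
    then have "\<mu> g * (\<mu> \<one> * deficit n g) \<le> \<mu> g * (return_prob n - walk (2 * n + 1) (inv g))"
      using walk_odd_deficit[of "inv g" n] density
      by (intro mult_left_mono) (auto simp: deficit_inv prob_density_def)
    then show ?thesis using \<open>g \<in> carrier G\<close> by (simp add: ac_simps)
  qed
  then have "(\<Sum>g\<in>F. \<mu> \<one> * (\<mu> g * deficit n g)) \<le> (\<Sum>g\<in>F. \<mu> g * (return_prob n - walk (2 * n + 1) (inv g \<otimes> \<one>)))"
    by (rule sum_mono)
  ultimately show ?thesis by (simp add: sum_distrib_left)
qed

lemma return_prob_Suc_le: "return_prob (Suc n) \<le> return_prob n"
  using energy_ge[of "{}" n] by simp

lemma decseq_return_prob: "decseq return_prob"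
  by (simp add: decseq_Suc_iff return_prob_Suc_le)

lemma return_prob_nonneg: "0 \<le> return_prob n"
  by (simp add: return_prob_def walk_nonneg)

text \<open>A Nash-type inequality. Averaging \<open>return_prob n = walk (2 * n) g + deficit n g\<close> over \<open>g\<close> in \<open>A\<close>,
the first term contributes at most \<open>1 / card A\<close> because \<open>walk (2 * n)\<close> has total mass 1.\<close>

lemma return_prob_le_volume:
  assumes A: "finite A" "A \<subseteq> carrier G" and r: "\<And>g. g \<in> A \<Longrightarrow> deficit n g \<le> r * (return_prob n - return_prob (Suc n))"
    and ne: "A \<noteq> {}"
  shows "return_prob n \<le> 1 / real (card A) + r * (return_prob n - return_prob (Suc n))"
proof -
  have "(\<Sum>g\<in>A. walk (2 * n) g) \<le> 1"
    by (rule finite_sum_le_has_sum[of _ "carrier G" 1])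
       (use A density_walk[of "2 * n"] in \<open>auto simp: prob_density_def\<close>)
  moreover have "(\<Sum>g\<in>A. deficit n g) \<le> (\<Sum>g\<in>A. r * (return_prob n - return_prob (Suc n)))"
    by (rule sum_mono) (rule r)
  moreover have "(\<Sum>g\<in>A. walk (2 * n) g) + (\<Sum>g\<in>A. deficit n g) = real (card A) * return_prob n"
    by (simp add: sum.distrib[symmetric] deficit_def)
  ultimately have "real (card A) * return_prob n \<le> 1 + real (card A) * (r * (return_prob n - return_prob (Suc n)))"
    by simp
  moreover have "0 < real (card A)" using A ne by (simp add: card_gt_0_iff)
  ultimately show ?thesis by (simp add: field_simps)
qed

end

section \<open>Inequalities for real sequences\<close>

text \<open>The recursion first gives a uniform bound; iterating it \<open>t\<close> times divides this bound by \<open>2 ^ t\<close> up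
to an error \<open>2 * \<delta>\<close>.\<close>

lemma halving_recursion_tendsto_0:
  fixes b :: "nat \<Rightarrow> real"
  assumes nonneg: "\<And>m. 0 \<le> b m"
    and rec: "\<And>\<delta>. \<delta> > 0 \<Longrightarrow> \<exists>m0. \<forall>m\<ge>m0. b m \<le> \<delta> + b (m div 2) / 2"
  shows "b \<longlonglongrightarrow> 0"
proof (rule LIMSEQ_I)
  fix r :: real assume r: "r > 0"
  define \<delta> where "\<delta> = r / 4"
  have \<delta>: "\<delta> > 0" using r by (simp add: \<delta>_def)
  obtain m1 where m1: "\<And>m. m \<ge> m1 \<Longrightarrow> b m \<le> \<delta> + b (m div 2) / 2"
    using rec[OF \<delta>] by blast
  define m0 where "m0 = max m1 1"
  define B where "B = (\<Sum>i<m0. b i)"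
  have B0: "0 \<le> B" unfolding B_def by (simp add: sum_nonneg nonneg)
  have base: "b m \<le> 2 * \<delta> + B" for m
  proof (induction m rule: less_induct)
    case (less m)
    show ?case
    proof (cases "m < m0")
      case True
      then have "b m \<le> B" unfolding B_def by (intro member_le_sum) (auto simp: nonneg)
      then show ?thesis using \<delta> by simp
    next
      case False
      then have "b m \<le> \<delta> + b (m div 2) / 2" by (intro m1) (simp add: m0_def)
      moreover have "b (m div 2) \<le> 2 * \<delta> + B" using False by (intro less) (simp add: m0_def)
      ultimately show ?thesis using B0 by simp
    qed
  qed
  have step: "\<forall>m \<ge> m0 * 2 ^ t. b m \<le> 2 * \<delta> + B / 2 ^ t" for t
  proof (induction t)
    case 0
    then show ?case using base by simp
  next
    case (Suc t)
    show ?case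
    proof (intro allI impI)
      fix m assume m: "m0 * 2 ^ Suc t \<le> m"
      define X where "X = B / 2 ^ t"
      have "m0 * 2 ^ t \<le> m div 2" using m by simp
      then have "b (m div 2) \<le> 2 * \<delta> + X" using Suc by (simp add: X_def)
      moreover have "m0 * 1 \<le> m0 * 2 ^ Suc t" by (intro mult_le_mono2) simp
      then have "b m \<le> \<delta> + b (m div 2) / 2" using m by (intro m1) (simp add: m0_def)
      ultimately have "b m \<le> 2 * \<delta> + X / 2" by argo
      then show "b m \<le> 2 * \<delta> + B / 2 ^ Suc t" by (simp add: X_def)
    qed
  qed
  obtain t where "B / \<delta> < 2 ^ t" using real_arch_pow[of 2 "B / \<delta>"] by auto
  then have t: "B / 2 ^ t < \<delta>" using \<delta> by (simp add: field_simps)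
  show "\<exists>no. \<forall>n\<ge>no. norm (b n - 0) < r"
  proof (intro exI allI impI)
    fix n assume "m0 * 2 ^ t \<le> n"
    then have "b n \<le> 2 * \<delta> + B / 2 ^ t" using step by blast
    then have "b n < 3 * \<delta>" using t by argo
    then have "b n < r" using r by (simp add: \<delta>_def)
    then show "norm (b n - 0) < r" using nonneg[of n] by simp
  qed
qed

text \<open>Summing the inequality over \<open>n, ..., 2 * n - 1\<close> makes the decrements telescope.\<close>

lemma sum_decrement_bound:
  fixes a :: "nat \<Rightarrow> real"
  assumes dec: "decseq a" and nonneg: "\<And>n. 0 \<le> a n" and q: "0 \<le> q"
    and ineq: "\<And>n. a n \<le> p + q * (a n - a (Suc n))"
  shows "real n * a (2 * n) \<le> real n * p + q * a n"
proof -
  have "real n * a (2 * n) = (\<Sum>j\<in>{n..<2 * n}. a (2 * n))" by simp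
  also have "\<dots> \<le> (\<Sum>j\<in>{n..<2 * n}. p + q * (a j - a (Suc j)))"
    using decseqD[OF dec] ineq by (intro sum_mono) (meson atLeastLessThan_iff order.trans less_imp_le)
  also have "\<dots> = real n * p + q * (\<Sum>j\<in>{n..<2 * n}. a j - a (Suc j))"
    by (simp add: sum.distrib sum_distrib_left)
  also have "(\<Sum>j\<in>{n..<2 * n}. a j - a (Suc j)) = a n - a (2 * n)"
    using sum_Suc_diff'[of n "2 * n" "\<lambda>j. - a j"] by simp
  also have "q * (a n - a (2 * n)) \<le> q * a n"
    using q nonneg[of "2 * n"] by (intro mult_left_mono) auto
  finally show ?thesis by simp
qed

text \<open>In \<open>sum_decrement_bound\<close> choose \<open>R\<close> proportional to \<open>sqrt n\<close>, with a factor so small that the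
decrement term contributes at most half of the preceding dyadic value; the volume term is then as
small as desired because \<open>K\<close> is arbitrary.\<close>

lemma nash_decay:
  fixes a :: "nat \<Rightarrow> real" and D :: nat and C :: real
  assumes dec: "decseq a" and nonneg: "\<And>n. 0 \<le> a n" and C: "C > 0"
    and nash: "\<And>K. K > 0 \<Longrightarrow> \<exists>R0. \<forall>R\<ge>R0. \<forall>n.
                 a n \<le> 1 / (K * real R ^ D) + (C * real R)\<^sup>2 * (a n - a (Suc n))"
  shows "(\<lambda>n. sqrt (real n) ^ D * a n) \<longlonglongrightarrow> 0"
proof (rule halving_recursion_tendsto_0)
  show "0 \<le> sqrt (real n) ^ D * a n" for n by (simp add: nonneg)
  fix \<delta> :: real assume \<delta>: "\<delta> > 0"
  define L where "L = sqrt 3 ^ D"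
  \<comment> \<open>\<open>L\<close> is lost in passing from \<open>m div 2\<close> to \<open>m \<le> 3 * (m div 2)\<close>; \<open>\<epsilon>\<close> leaves a factor 1/2 after that.\<close>
  define \<epsilon> where "\<epsilon> = 1 / (2 * L)"
  have L: "L > 0" by (simp add: L_def)
  then have \<epsilon>: "\<epsilon> > 0" by (simp add: \<epsilon>_def)
  define c where "c = sqrt \<epsilon> / C"
  have c: "c > 0" using C \<epsilon> by (simp add: c_def)
  define K where "K = L * (2 / c) ^ D / \<delta>"
  have K: "K > 0" using L c \<delta> by (simp add: K_def)
  obtain R0 where R0: "\<And>R n. R \<ge> R0 \<Longrightarrow>
      a n \<le> 1 / (K * real R ^ D) + (C * real R)\<^sup>2 * (a n - a (Suc n))"
    using nash[OF K] by blast
  obtain n1 :: nat where n1: "real n1 > ((real R0 + 1) / c)\<^sup>2" using reals_Archimedean2 by blast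
  show "\<exists>m0. \<forall>m\<ge>m0. sqrt (real m) ^ D * a m \<le> \<delta> + (sqrt (real (m div 2)) ^ D * a (m div 2)) / 2"
  proof (intro exI allI impI)
    fix m assume m: "2 * n1 + 2 \<le> m"
    define n where "n = m div 2"
    have n: "n \<ge> n1" "n \<ge> 1" "2 * n \<le> m" "m \<le> 3 * n" using m by (auto simp: n_def)
    define R where "R = nat \<lfloor>c * sqrt (real n)\<rfloor>"
    have "((real R0 + 1) / c)\<^sup>2 \<le> real n" using n1 n by linarith
    then have "(real R0 + 1) / c \<le> sqrt (real n)" by (rule real_le_rsqrt)
    then have large: "real R0 + 1 \<le> c * sqrt (real n)" using c by (simp add: field_simps)
    then have Rle: "real R \<le> c * sqrt (real n)" and Rge: "c * sqrt (real n) < real R + 1" "R \<ge> R0" "R \<ge> 1"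
      unfolding R_def by linarith+
    have half: "c * sqrt (real n) \<le> 2 * real R" using Rge by linarith
    have "(C * real R)\<^sup>2 \<le> (C * (c * sqrt (real n)))\<^sup>2"
      using Rle C by (intro power_mono mult_left_mono) auto
    also have "\<dots> = \<epsilon> * real n" using C \<epsilon> by (simp add: c_def power_mult_distrib)
    finally have q: "(C * real R)\<^sup>2 \<le> \<epsilon> * real n" .
    have "real n * a (2 * n) \<le> real n * (1 / (K * real R ^ D)) + (C * real R)\<^sup>2 * a n"
      by (rule sum_decrement_bound[OF dec nonneg]) (use R0 Rge in auto)
    also have "\<dots> \<le> real n * (1 / (K * real R ^ D)) + (\<epsilon> * real n) * a n"
      by (intro add_left_mono mult_right_mono q nonneg)
    also have "\<dots> = real n * (1 / (K * real R ^ D) + \<epsilon> * a n)" by (simp add: algebra_simps)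
    finally have a2: "a (2 * n) \<le> 1 / (K * real R ^ D) + \<epsilon> * a n" using n by simp
    have "sqrt (real m) ^ D * a m \<le> (sqrt 3 * sqrt (real n)) ^ D * a (2 * n)"
      using n decseqD[OF dec, of "2 * n" m]
      by (intro mult_mono power_mono) (auto simp: nonneg real_sqrt_mult[symmetric])
    also have "\<dots> = L * sqrt (real n) ^ D * a (2 * n)" by (simp add: L_def power_mult_distrib)
    also have "\<dots> \<le> L * sqrt (real n) ^ D * (1 / (K * real R ^ D) + \<epsilon> * a n)"
      using L by (intro mult_left_mono a2) auto
    also have "\<dots> = L * (sqrt (real n) ^ D / (K * real R ^ D)) + sqrt (real n) ^ D * a n / 2"
      using L by (simp add: \<epsilon>_def field_simps)
    also have "sqrt (real n) ^ D / (K * real R ^ D) \<le> (2 / c * real R) ^ D / (K * real R ^ D)"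
      using half c K by (intro divide_right_mono power_mono) (auto simp: field_simps)
    also have "\<dots> = \<delta> / L"
      using Rge K \<delta> L c by (simp add: K_def power_mult_distrib field_simps)
    finally show "sqrt (real m) ^ D * a m \<le> \<delta> + (sqrt (real (m div 2)) ^ D * a (m div 2)) / 2"
      using L by (simp add: n_def)
  qed
qed

text \<open>Splitting \<open>m\<close> as \<open>q + (m - q)\<close> in all possible ways bounds \<open>\<phi> m\<close> by four times the average of \<open>\<phi>\<close> on
\<open>0, ..., m\<close>, on which the weights are at least \<open>(1 + m) powr (- \<alpha> - 1)\<close>.\<close>

lemma averaging_bound:
  fixes \<phi> :: "nat \<Rightarrow> real"
  assumes nonneg: "\<And>m. 0 \<le> \<phi> m" and add: "\<And>m n. \<phi> (m + n) \<le> 2 * \<phi> m + 2 * \<phi> n"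
    and \<alpha>: "\<alpha> > 0" and energy: "(\<Sum>q\<le>m. (1 + real q) powr (- \<alpha> - 1) * \<phi> q) \<le> E"
  shows "\<phi> m \<le> 4 * (1 + real m) powr \<alpha> * E"
proof -
  have "(1 + real m) * \<phi> m = (\<Sum>q\<le>m. \<phi> m)" by simp
  also have "\<dots> \<le> (\<Sum>q\<le>m. 2 * \<phi> q + 2 * \<phi> (m - q))"
    by (rule sum_mono) (metis add le_add_diff_inverse atMost_iff)
  also have "\<dots> = 2 * (\<Sum>q\<le>m. \<phi> q) + 2 * (\<Sum>q\<le>m. \<phi> (m - q))"
    by (simp add: sum.distrib sum_distrib_left)
  also have "(\<Sum>q\<le>m. \<phi> (m - q)) = (\<Sum>q\<le>m. \<phi> q)"
    using sum.nat_diff_reindex[of \<phi> "Suc m"] by (simp add: lessThan_Suc_atMost)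
  also have "2 * (\<Sum>q\<le>m. \<phi> q) + 2 * (\<Sum>q\<le>m. \<phi> q) = 4 * (\<Sum>q\<le>m. \<phi> q)" by simp
  also have "(\<Sum>q\<le>m. \<phi> q) \<le> (\<Sum>q\<le>m. (1 + real m) powr (\<alpha> + 1) * ((1 + real q) powr (- \<alpha> - 1) * \<phi> q))"
  proof (rule sum_mono)
    fix q assume q: "q \<in> {..m}"
    have "1 = (1 + real q) powr (\<alpha> + 1) * (1 + real q) powr (- \<alpha> - 1)"
      by (simp add: powr_add[symmetric])
    also have "\<dots> \<le> (1 + real m) powr (\<alpha> + 1) * (1 + real q) powr (- \<alpha> - 1)"
      using q \<alpha> by (intro mult_right_mono powr_mono2) auto
    finally show "\<phi> q \<le> (1 + real m) powr (\<alpha> + 1) * ((1 + real q) powr (- \<alpha> - 1) * \<phi> q)"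
      using mult_right_mono[OF _ nonneg[of q]] by fastforce
  qed
  also have "\<dots> = (1 + real m) powr (\<alpha> + 1) * (\<Sum>q\<le>m. (1 + real q) powr (- \<alpha> - 1) * \<phi> q)"
    by (simp add: sum_distrib_left)
  also have "\<dots> \<le> (1 + real m) powr (\<alpha> + 1) * E"
    using energy by (intro mult_left_mono) auto
  finally have "(1 + real m) * \<phi> m \<le> 4 * ((1 + real m) powr (\<alpha> + 1) * E)" by simp
  also have "(1 + real m) powr (\<alpha> + 1) = (1 + real m) * (1 + real m) powr \<alpha>"
    by (simp add: powr_add)
  finally have "(1 + real m) * \<phi> m \<le> (1 + real m) * (4 * (1 + real m) powr \<alpha> * E)"
    by (simp add: mult_ac)
  then show ?thesis by (simp add: mult_le_cancel_left)
qed

text \<open>For \<open>\<alpha> = 2\<close> the averaging argument loses nothing on any scale: every block \<open>[4^j, 4^(j+1))\<close> of the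
energy alone controls \<open>\<phi>\<close> up to \<open>4 ^ j\<close>, and subadditivity of the square root transports this to \<open>4 ^ J\<close>
with the factor \<open>16 ^ (J - j)\<close>. Adding the \<open>J\<close> resulting bounds gains the factor \<open>J\<close>, which is logarithmic
in \<open>4 ^ J\<close>.\<close>

lemma critical_averaging_bound:
  fixes \<phi> :: "nat \<Rightarrow> real"
  assumes nonneg: "\<And>m. 0 \<le> \<phi> m" and add: "\<And>m n. \<phi> (m + n) \<le> 2 * \<phi> m + 2 * \<phi> n"
    and diff: "\<And>m n. \<phi> m \<le> 2 * \<phi> (n + m) + 2 * \<phi> n"
    and energy: "(\<Sum>q<4 ^ J. (1 + real q) powr (- 3) * \<phi> q) \<le> E"
    and m: "m \<le> 4 ^ J"
  shows "real J * \<phi> m \<le> 256 * 16 ^ J * E"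
proof -
  define T where "T = (\<lambda>j::nat. \<Sum>q<4 ^ j. (1 + real q) powr (- 3) * \<phi> q)"
  have block: "\<phi> p \<le> 256 * 16 ^ j * (T (Suc j) - T j)" if p: "p \<le> 4 ^ j" for j p
  proof -
    let ?B = "{4 ^ j..<4 ^ Suc j} :: nat set" and ?H = "{4 ^ j..<2 * 4 ^ j} :: nat set"
    have T: "T (Suc j) - T j = (\<Sum>q\<in>?B. (1 + real q) powr (- 3) * \<phi> q)"
      unfolding T_def by (subst sum_diff_nat_ivl[of 0, simplified, symmetric]) 
        (auto simp: lessThan_atLeast0 sum_diff_nat_ivl)
    have "4 ^ j * \<phi> p = (\<Sum>q\<in>?H. \<phi> p)" by simp
    also have "\<dots> \<le> (\<Sum>q\<in>?H. 2 * \<phi> (q + p) + 2 * \<phi> q)" by (intro sum_mono diff)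
    also have "\<dots> = 2 * (\<Sum>q\<in>?H. \<phi> (q + p)) + 2 * (\<Sum>q\<in>?H. \<phi> q)"
      by (simp add: sum.distrib sum_distrib_left)
    also have "(\<Sum>q\<in>?H. \<phi> (q + p)) = (\<Sum>q\<in>(\<lambda>q. q + p) ` ?H. \<phi> q)"
      by (subst sum.reindex) auto
    also have "\<dots> \<le> (\<Sum>q\<in>?B. \<phi> q)"
      using p by (intro sum_mono2) (auto simp: nonneg)
    also have "(\<Sum>q\<in>?H. \<phi> q) \<le> (\<Sum>q\<in>?B. \<phi> q)"
      by (intro sum_mono2) (auto simp: nonneg)
    finally have 1: "4 ^ j * \<phi> p \<le> 4 * (\<Sum>q\<in>?B. \<phi> q)" by simp
    have "(\<Sum>q\<in>?B. \<phi> q) \<le> (\<Sum>q\<in>?B. (4 ^ Suc j) ^ 3 * ((1 + real q) powr (- 3) * \<phi> q))"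
    proof (rule sum_mono)
      fix q assume q: "q \<in> ?B"
      then have "real (Suc q) \<le> real (4 ^ Suc j)" by (intro of_nat_mono) auto
      then have "1 + real q \<le> 4 ^ Suc j" by simp
      then have "(1 + real q) ^ 3 \<le> (4 ^ Suc j) ^ 3" by (intro power_mono) auto
      then have "(1 + real q) ^ 3 * (1 + real q) powr (- 3) \<le> (4 ^ Suc j) ^ 3 * (1 + real q) powr (- 3)"
        by (rule mult_right_mono) simp
      moreover have "(1 + real q) ^ 3 * (1 + real q) powr (- 3) = 1"
        by (simp add: powr_minus powr_numeral)
      ultimately have "1 \<le> (4 ^ Suc j) ^ 3 * (1 + real q) powr (- 3)" by simp
      then show "\<phi> q \<le> (4 ^ Suc j) ^ 3 * ((1 + real q) powr (- 3) * \<phi> q)"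
        using mult_right_mono[OF _ nonneg[of q]] by fastforce
    qed
    also have "\<dots> = (4 ^ Suc j) ^ 3 * (T (Suc j) - T j)" unfolding T by (simp add: sum_distrib_left)
    finally have "4 ^ j * \<phi> p \<le> 4 * ((4 ^ Suc j) ^ 3 * (T (Suc j) - T j))" using 1 by simp
    also have "\<dots> = 4 ^ j * (256 * 16 ^ j * (T (Suc j) - T j))"
    proof -
      have "(16::real) ^ j = 4 ^ j * 4 ^ j" by (simp add: power_mult_distrib[symmetric])
      then show ?thesis by (simp add: power3_eq_cube)
    qed
    finally show ?thesis by simp
  qed
  have double: "\<forall>p \<le> 2 * X. \<phi> p \<le> 4 * M" if "\<forall>p \<le> X. \<phi> p \<le> M" for X M
  proof (intro allI impI)
    fix p assume p: "p \<le> 2 * X"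
    have "\<phi> p \<le> 2 * \<phi> (p div 2) + 2 * \<phi> (p - p div 2)"
      using add[of "p div 2" "p - p div 2"] by simp
    moreover have "\<phi> (p div 2) \<le> M" "\<phi> (p - p div 2) \<le> M" using that p by auto
    ultimately show "\<phi> p \<le> 4 * M" by linarith
  qed
  have scale: "\<forall>p \<le> 4 ^ (j + i). \<phi> p \<le> 16 ^ i * (256 * 16 ^ j * (T (Suc j) - T j))" for i j
  proof (induction i)
    case 0
    then show ?case using block by simp
  next
    case (Suc i)
    show ?case using double[OF double[OF Suc]] by simp
  qed
  have "real J * \<phi> m = (\<Sum>j<J. \<phi> m)" by simp
  also have "\<dots> \<le> (\<Sum>j<J. 256 * 16 ^ J * (T (Suc j) - T j))"
  proof (rule sum_mono)
    fix j assume j: "j \<in> {..<J}"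
    have "\<phi> m \<le> 16 ^ (J - j) * (256 * 16 ^ j * (T (Suc j) - T j))"
      using scale[of j "J - j"] m j by simp
    moreover have "(16::real) ^ J = 16 ^ (J - j) * 16 ^ j" using j by (simp add: power_add[symmetric])
    ultimately show "\<phi> m \<le> 256 * 16 ^ J * (T (Suc j) - T j)" by simp
  qed
  also have "\<dots> = 256 * 16 ^ J * (T J - T 0)"
    by (simp add: sum_distrib_left[symmetric] sum_lessThan_telescope)
  also have "\<dots> \<le> 256 * 16 ^ J * E"
    using energy nonneg[of 0] by (intro mult_left_mono) (auto simp: T_def)
  finally show ?thesis .
qed

section \<open>The length function of a random walk\<close>

text \<open>A length function in the weak sense: nontrivial elements may have length 0.\<close>

locale group_length = group G for G :: "('a, 'b) monoid_scheme" (structure) +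
  fixes len :: "'a \<Rightarrow> real"
  assumes len_nonneg: "g \<in> carrier G \<Longrightarrow> 0 \<le> len g"
    and len_one: "len \<one> = 0"
    and len_inv: "g \<in> carrier G \<Longrightarrow> len (inv g) = len g"
    and len_mult: "\<lbrakk>g \<in> carrier G; h \<in> carrier G\<rbrakk> \<Longrightarrow> len (g \<otimes> h) \<le> len g + len h"

locale irreducible_walk = symmetric_walk +
  assumes support_generates: "generate G {g \<in> carrier G. 0 < \<mu> g} = carrier G"
begin

text \<open>The energy is the quantity that controls all deficits; \<open>controlled g \<rho>\<close> is this control in terms of
square roots, in which form it is subadditive in \<open>g\<close>.\<close>

definition energy :: "nat \<Rightarrow> real" where "energy n = return_prob n - return_prob (Suc n)"

definition controlled :: "'a \<Rightarrow> real \<Rightarrow> bool" where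
  "controlled g \<rho> \<longleftrightarrow> 0 \<le> \<rho> \<and> (\<forall>n. sqrt (deficit n g) \<le> \<rho> * sqrt (energy n))"

definition len :: "'a \<Rightarrow> real" where "len g = Inf {\<rho>. controlled g \<rho>}"

lemma energy_nonneg: "0 \<le> energy n"
  using return_prob_Suc_le[of n] by (simp add: energy_def)

lemma controlled_iff_deficit:
  assumes "0 \<le> \<rho>" "g \<in> carrier G"
  shows "controlled g \<rho> \<longleftrightarrow> (\<forall>n. deficit n g \<le> \<rho>\<^sup>2 * energy n)"
proof -
  have "sqrt (deficit n g) \<le> \<rho> * sqrt (energy n) \<longleftrightarrow> deficit n g \<le> \<rho>\<^sup>2 * energy n" for n
  proof -
    have "\<rho> * sqrt (energy n) = sqrt (\<rho>\<^sup>2 * energy n)" using assms by (simp add: real_sqrt_mult)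
    then show ?thesis by simp
  qed
  then show ?thesis using assms by (simp add: controlled_def)
qed

lemma controlled_mult:
  assumes "controlled g \<rho>" "controlled h \<sigma>" "g \<in> carrier G" "h \<in> carrier G"
  shows "controlled (g \<otimes> h) (\<rho> + \<sigma>)"
  unfolding controlled_def
proof (intro conjI allI)
  show "0 \<le> \<rho> + \<sigma>" using assms by (simp add: controlled_def)
  fix n
  have "sqrt (deficit n (g \<otimes> h)) \<le> sqrt (deficit n g) + sqrt (deficit n h)"
    by (rule sqrt_deficit_mult) (use assms in auto)
  also have "\<dots> \<le> \<rho> * sqrt (energy n) + \<sigma> * sqrt (energy n)"
    using assms by (intro add_mono) (auto simp: controlled_def)
  finally show "sqrt (deficit n (g \<otimes> h)) \<le> (\<rho> + \<sigma>) * sqrt (energy n)" by (simp add: algebra_simps)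
qed

lemma controlled_inv: "g \<in> carrier G \<Longrightarrow> controlled (inv g) \<rho> \<longleftrightarrow> controlled g \<rho>"
  by (simp add: controlled_def deficit_inv)

lemma controlled_one: "controlled \<one> 0"
  by (simp add: controlled_def deficit_one)

text \<open>Elements charged by \<open>\<mu>\<close> are controlled since each of them contributes to the Dirichlet form, and they
generate the group.\<close>

lemma ex_controlled:
  assumes "g \<in> carrier G"
  shows "\<exists>\<rho>. controlled g \<rho>"
proof -
  have "g \<in> generate G {g \<in> carrier G. 0 < \<mu> g}" using assms support_generates by simp
  then show ?thesis
  proof (induction rule: generate.induct)
    case one
    then show ?case using controlled_one by blast
  next
    case (incl h)
    have "deficit n h \<le> (sqrt (1 / (\<mu> \<one> * \<mu> h)))\<^sup>2 * energy n" for n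
      using energy_ge[of "{h}" n] incl lazy by (simp add: energy_def field_simps)
    then show ?case
      using controlled_iff_deficit[of "sqrt (1 / (\<mu> \<one> * \<mu> h))" h] incl lazy by auto
  next
    case (inv h)
    have "deficit n h \<le> (sqrt (1 / (\<mu> \<one> * \<mu> h)))\<^sup>2 * energy n" for n
      using energy_ge[of "{h}" n] inv lazy by (simp add: energy_def field_simps)
    then show ?case
      using controlled_iff_deficit[of "sqrt (1 / (\<mu> \<one> * \<mu> h))" h] inv lazy controlled_inv[of h] by auto
  next
    case (eng h1 h2)
    have "h1 \<in> carrier G" "h2 \<in> carrier G"
      using eng.hyps support_generates by simp_all
    then show ?case using eng.IH by (metis controlled_mult)
  qed
qed

lemma len_le: "controlled g \<rho> \<Longrightarrow> len g \<le> \<rho>"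
  unfolding len_def by (intro cInf_lower) (auto intro!: bdd_belowI[of _ 0] simp: controlled_def)

lemma controlled_len:
  assumes "g \<in> carrier G"
  shows "controlled g (len g)"
  unfolding controlled_def
proof (intro conjI allI)
  have ne: "{\<rho>. controlled g \<rho>} \<noteq> {}" using ex_controlled[OF assms] by auto
  show "0 \<le> len g"
    unfolding len_def using ne by (intro cInf_greatest) (auto simp: controlled_def)
  fix n
  show "sqrt (deficit n g) \<le> len g * sqrt (energy n)"
  proof (cases "energy n = 0")
    case True
    obtain \<rho> where "controlled g \<rho>" using ne by auto
    then have "sqrt (deficit n g) \<le> \<rho> * sqrt (energy n)" by (simp add: controlled_def)
    then show ?thesis using True by simp
  next
    case False
    then have pos: "0 < sqrt (energy n)" using energy_nonneg[of n] by simp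
    have "sqrt (deficit n g) / sqrt (energy n) \<le> len g"
      unfolding len_def using ne pos
      by (intro cInf_greatest) (auto simp: controlled_def pos_divide_le_eq)
    then show ?thesis using pos by (simp add: pos_divide_le_eq)
  qed
qed

sublocale group_length G len
proof unfold_locales
  show nn: "0 \<le> len g" if "g \<in> carrier G" for g
    using controlled_len[OF that] by (simp add: controlled_def)
  show "len \<one> = 0" using len_le[OF controlled_one] nn[of \<one>] by simp
  show "len (inv g) = len g" if "g \<in> carrier G" for g
    using that by (simp add: len_def controlled_inv)
  show "len (g \<otimes> h) \<le> len g + len h" if "g \<in> carrier G" "h \<in> carrier G" for g h
    using that by (intro len_le controlled_mult controlled_len)
qed

lemma deficit_le_len: "g \<in> carrier G \<Longrightarrow> deficit n g \<le> (len g)\<^sup>2 * energy n"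
  using controlled_len[of g] controlled_iff_deficit[of "len g" g] len_nonneg[of g] by blast

lemma len_le_sqrt:
  assumes "g \<in> carrier G" "0 \<le> c" "\<And>n. deficit n g \<le> c * energy n"
  shows "len g \<le> sqrt c"
  using assms controlled_iff_deficit[of "sqrt c" g] by (intro len_le) simp

lemma return_prob_tendsto_0:
  fixes D :: nat and C :: real
  assumes C: "C > 0"
    and volume: "\<And>K. K > 0 \<Longrightarrow> \<exists>R0. \<forall>R\<ge>R0. \<exists>A. finite A \<and> A \<subseteq> carrier G \<and>
          K * real R ^ D \<le> real (card A) \<and> (\<forall>g\<in>A. len g \<le> C * real R)"
  shows "(\<lambda>n. sqrt (real n) ^ D * return_prob n) \<longlonglongrightarrow> 0"
proof (rule nash_decay[OF decseq_return_prob return_prob_nonneg C])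
  fix K :: real assume K: "K > 0"
  obtain R0 where R0: "\<And>R. R \<ge> R0 \<Longrightarrow> \<exists>A. finite A \<and> A \<subseteq> carrier G \<and>
          K * real R ^ D \<le> real (card A) \<and> (\<forall>g\<in>A. len g \<le> C * real R)"
    using volume[OF K] by blast
  show "\<exists>R0. \<forall>R\<ge>R0. \<forall>n. return_prob n \<le> 1 / (K * real R ^ D) + (C * real R)\<^sup>2 * (return_prob n - return_prob (Suc n))"
  proof (intro exI allI impI)
    fix R n assume R: "max R0 1 \<le> R"
    obtain A where A: "finite A" "A \<subseteq> carrier G" "K * real R ^ D \<le> real (card A)"
      "\<And>g. g \<in> A \<Longrightarrow> len g \<le> C * real R" using R0[of R] R by auto
    have pos: "0 < K * real R ^ D" using K R by simp
    then have ne: "A \<noteq> {}" using A(3) by auto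
    have "return_prob n \<le> 1 / real (card A) + (C * real R)\<^sup>2 * (return_prob n - return_prob (Suc n))"
    proof (rule return_prob_le_volume[OF A(1,2) _ ne])
      fix g assume g: "g \<in> A"
      then have gc: "g \<in> carrier G" using A by auto
      have "deficit n g \<le> (len g)\<^sup>2 * energy n" by (rule deficit_le_len[OF gc])
      also have "\<dots> \<le> (C * real R)\<^sup>2 * energy n"
        using A(4)[OF g] len_nonneg[OF gc] energy_nonneg by (intro mult_right_mono power_mono) auto
      finally show "deficit n g \<le> (C * real R)\<^sup>2 * (return_prob n - return_prob (Suc n))"
        by (simp add: energy_def)
    qed
    also have "1 / real (card A) \<le> 1 / (K * real R ^ D)"
      using A(3) pos by (intro divide_left_mono) auto
    finally show "return_prob n \<le> 1 / (K * real R ^ D) + (C * real R)\<^sup>2 * (return_prob n - return_prob (Suc n))"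
      by simp
  qed
qed

text \<open>Odd times are covered by \<open>walk_odd_le\<close>, which bounds the return probability at time \<open>2 * n + 1\<close> by
the one at time \<open>2 * n\<close>.\<close>

lemma walk_one_tendsto_0:
  fixes D :: nat
  assumes "(\<lambda>n. sqrt (real n) ^ D * return_prob n) \<longlonglongrightarrow> 0"
  shows "(\<lambda>n. real n powr (real D / 2) * walk n \<one>) \<longlonglongrightarrow> 0"
proof (rule tendsto_sandwich[where f = "\<lambda>_. 0"])
  have "filterlim (\<lambda>n::nat. n div 2) sequentially sequentially"
    unfolding filterlim_at_top
  proof
    fix Z :: nat
    show "\<forall>\<^sub>F n in sequentially. Z \<le> n div 2" by (rule eventually_sequentiallyI[of "2 * Z"]) auto
  qed
  then have "(\<lambda>n. sqrt (real (n div 2)) ^ D * return_prob (n div 2)) \<longlonglongrightarrow> 0"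
    using assms by (rule filterlim_compose[rotated])
  then show "(\<lambda>n. sqrt 3 ^ D * (sqrt (real (n div 2)) ^ D * return_prob (n div 2))) \<longlonglongrightarrow> 0"
    using tendsto_mult_left[of _ 0 sequentially "sqrt 3 ^ D"] by simp
  have "real n powr (real D / 2) * walk n \<one> \<le> sqrt 3 ^ D * (sqrt (real (n div 2)) ^ D * return_prob (n div 2))" 
    if n: "n \<ge> 2" for n
  proof -
    have "real n powr (real D / 2) = sqrt (real n) ^ D"
      using n by (simp add: powr_half_sqrt[symmetric] powr_realpow[symmetric] powr_powr)
    also have "\<dots> \<le> sqrt (real (3 * (n div 2))) ^ D"
      using n by (intro power_mono real_sqrt_le_mono of_nat_mono) auto
    also have "\<dots> = (sqrt 3 * sqrt (real (n div 2))) ^ D" by (simp add: real_sqrt_mult)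
    finally have 1: "real n powr (real D / 2) \<le> sqrt 3 ^ D * sqrt (real (n div 2)) ^ D"
      by (simp add: power_mult_distrib)
    have "walk n \<one> \<le> return_prob (n div 2)"
      using walk_even_le[of \<one> "n div 2"] walk_odd_le[of \<one> "n div 2"]
      by (cases "even n") (auto simp: elim!: oddE evenE)
    then show ?thesis
      using mult_mono[OF 1, of "walk n \<one>" "return_prob (n div 2)"] walk_nonneg[of \<one> n] by (simp add: mult.assoc)
  qed
  then show "\<forall>\<^sub>F n in sequentially. real n powr (real D / 2) * walk n \<one> \<le> sqrt 3 ^ D * (sqrt (real (n div 2)) ^ D * return_prob (n div 2))"
    by (intro eventually_sequentiallyI[of 2])
qed (auto simp: walk_nonneg)

context
  fixes s :: 'a and \<alpha> c :: real
  assumes s: "s \<in> carrier G" and inf_order: "inj (\<lambda>m::nat. s [^] m)" and c: "0 < c"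
    and heavy_tail: "\<And>m::nat. c * (1 + real m) powr (- \<alpha> - 1) \<le> \<mu> (s [^] m)"
begin

text \<open>The powers of \<open>s\<close> are distinct, so they contribute separately to the Dirichlet form.\<close>

lemma power_energy:
  assumes "finite F"
  shows "(\<Sum>q\<in>F. (1 + real q) powr (- \<alpha> - 1) * deficit n (s [^] q)) \<le> energy n / (c * \<mu> \<one>)"
proof -
  have "\<mu> \<one> * (\<Sum>q\<in>F. c * ((1 + real q) powr (- \<alpha> - 1) * deficit n (s [^] q))) \<le> 
     \<mu> \<one> * (\<Sum>q\<in>F. \<mu> (s [^] q) * deficit n (s [^] q))"
    using lazy heavy_tail s
    by (intro mult_left_mono sum_mono) (auto simp: mult.assoc[symmetric] intro!: mult_right_mono deficit_nonneg)
  also have "(\<Sum>q\<in>F. \<mu> (s [^] q) * deficit n (s [^] q)) = (\<Sum>g\<in>(\<lambda>q. s [^] q) ` F. \<mu> g * deficit n g)"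
    by (subst sum.reindex) (auto intro: inj_on_subset[OF inf_order])
  also have "\<mu> \<one> * \<dots> \<le> energy n"
    unfolding energy_def by (rule energy_ge) (use assms s in auto)
  finally show ?thesis using c lazy by (simp add: sum_distrib_left[symmetric] field_simps)
qed

lemma deficit_mult_le:
  assumes "g \<in> carrier G" "h \<in> carrier G"
  shows "deficit n (g \<otimes> h) \<le> 2 * deficit n g + 2 * deficit n h"
proof -
  have "deficit n (g \<otimes> h) = (sqrt (deficit n (g \<otimes> h)))\<^sup>2" using assms by (simp add: deficit_nonneg)
  also have "\<dots> \<le> (sqrt (deficit n g) + sqrt (deficit n h))\<^sup>2"
    using assms by (intro power_mono sqrt_deficit_mult) (auto simp: deficit_nonneg)
  also have "\<dots> \<le> 2 * (sqrt (deficit n g))\<^sup>2 + 2 * (sqrt (deficit n h))\<^sup>2"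
    using sum_squares_bound[of "sqrt (deficit n g)" "sqrt (deficit n h)"] by (simp add: power2_sum)
  finally show ?thesis using assms by (simp add: deficit_nonneg)
qed

lemma deficit_power_add: "deficit n (s [^] (p + q)) \<le> 2 * deficit n (s [^] p) + 2 * deficit n (s [^] (q::nat))"
  using deficit_mult_le[of "s [^] p" "s [^] q" n] s by (simp add: nat_pow_mult)

lemma len_power_le:
  assumes "\<alpha> > 0"
  shows "len (s [^] (m::nat)) \<le> sqrt (4 / (c * \<mu> \<one>)) * (1 + real m) powr (\<alpha> / 2)"
proof -
  have "len (s [^] m) \<le> sqrt (4 / (c * \<mu> \<one>) * (1 + real m) powr \<alpha>)"
  proof (rule len_le_sqrt)
    fix n
    have "deficit n (s [^] m) \<le> 4 * (1 + real m) powr \<alpha> * (energy n / (c * \<mu> \<one>))"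
      by (rule averaging_bound[OF _ deficit_power_add assms power_energy]) (use s in \<open>auto simp: deficit_nonneg\<close>)
    then show "deficit n (s [^] m) \<le> 4 / (c * \<mu> \<one>) * (1 + real m) powr \<alpha> * energy n" by simp
  qed (use s c lazy in auto)
  also have "sqrt (4 / (c * \<mu> \<one>) * (1 + real m) powr \<alpha>) = sqrt (4 / (c * \<mu> \<one>)) * (1 + real m) powr (\<alpha> / 2)"
    unfolding real_sqrt_mult[of "4 / (c * \<mu> \<one>)"] by (simp add: powr_half_sqrt[symmetric] powr_powr)
  finally show ?thesis .
qed

lemma len_power_le_critical:
  assumes "\<alpha> = 2" "m \<le> 4 ^ J" "J > 0"
  shows "len (s [^] (m::nat)) \<le> sqrt (256 * 16 ^ J / (c * \<mu> \<one> * real J))"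
proof (rule len_le_sqrt)
  fix n
  have "real J * deficit n (s [^] m) \<le> 256 * 16 ^ J * (energy n / (c * \<mu> \<one>))"
  proof (rule critical_averaging_bound[OF _ deficit_power_add _ _ assms(2)])
    fix p q :: nat
    have "s [^] p = inv (s [^] q) \<otimes> s [^] (q + p)"
      using s by (simp add: nat_pow_mult[symmetric])
    then show "deficit n (s [^] p) \<le> 2 * deficit n (s [^] (q + p)) + 2 * deficit n (s [^] q)"
      using deficit_mult_le[of "inv (s [^] q)" "s [^] (q + p)" n] s by (simp add: deficit_inv)
  qed (use s power_energy[of "{..<4 ^ J}" n] assms in \<open>auto simp: deficit_nonneg\<close>)
  then have "deficit n (s [^] m) \<le> 256 * 16 ^ J * (energy n / (c * \<mu> \<one>)) / real J"
    using assms(3) by (subst pos_le_divide_eq) (simp_all only: of_nat_0_less_iff mult.commute)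
  then show "deficit n (s [^] m) \<le> 256 * 16 ^ J / (c * \<mu> \<one> * real J) * energy n"
    by (simp add: mult_ac)
qed (use s c lazy in auto)

text \<open>If \<open>\<alpha> * l < 2\<close>, then \<open>len (s [^] m)\<close> is of order \<open>m powr (\<alpha> / 2)\<close>, which for \<open>m \<le> K * R ^ l\<close> is
\<open>o(R)\<close>. In the critical case \<open>\<alpha> = 2\<close>, \<open>l = 1\<close> this exponent only gives \<open>O(K * R)\<close>, and the logarithmic gain of
\<open>critical_averaging_bound\<close> absorbs the factor \<open>K\<close>.\<close>

lemma superlinear_powers:
  fixes l :: nat and K :: real
  assumes \<alpha>: "0 < \<alpha>" and "(\<alpha> = 2 \<and> l = 1) \<or> \<alpha> * real l < 2"
  shows "\<exists>R0. \<forall>R\<ge>R0. \<forall>m::nat. real m \<le> K * real R ^ l \<longrightarrow> 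
           len (s [^] m) \<le> sqrt (4 / (c * \<mu> \<one>)) * real R"
  using assms(2)
proof
  assume lt: "\<alpha> * real l < 2"
  define K' where "K' = max K 0 + 1"
  have "((\<lambda>x::real. x powr (\<alpha> * real l / 2 - 1)) \<longlongrightarrow> 0) at_top"
    using lt by (intro tendsto_neg_powr) (auto intro: filterlim_ident)
  then have "(\<lambda>R::nat. real R powr (\<alpha> * real l / 2 - 1)) \<longlonglongrightarrow> 0"
    by (rule filterlim_compose) (rule filterlim_real_sequentially)
  then have "\<forall>\<^sub>F R::nat in sequentially. real R powr (\<alpha> * real l / 2 - 1) < K' powr (- \<alpha> / 2)"
    by (rule order_tendstoD) (simp add: K'_def)
  then obtain R1 where R1: "\<And>R::nat. R \<ge> R1 \<Longrightarrow> real R powr (\<alpha> * real l / 2 - 1) < K' powr (- \<alpha> / 2)"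
    unfolding eventually_sequentially by blast
  show ?thesis
  proof (intro exI allI impI)
    fix R m :: nat assume R: "max R1 1 \<le> R" and m: "real m \<le> K * real R ^ l"
    have "1 + real m \<le> K' * real R ^ l"
    proof -
      have "K * real R ^ l \<le> max K 0 * real R ^ l" by (intro mult_right_mono) auto
      moreover have "1 \<le> real R ^ l" using R by (simp add: one_le_power)
      ultimately show ?thesis using m by (simp add: K'_def algebra_simps)
    qed
    then have "(1 + real m) powr (\<alpha> / 2) \<le> (K' * real R ^ l) powr (\<alpha> / 2)"
      using \<alpha> by (intro powr_mono2) auto
    also have "\<dots> = K' powr (\<alpha> / 2) * real R powr (\<alpha> * real l / 2)"
    proof -
      have "real R ^ l = real R powr real l" using R by (simp add: powr_realpow)
      then have "(real R ^ l) powr (\<alpha> / 2) = real R powr (\<alpha> * real l / 2)"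
        by (simp only: powr_powr) (simp add: mult.commute)
      then show ?thesis by (simp add: powr_mult K'_def)
    qed
    also have "real R powr (\<alpha> * real l / 2) = real R powr (\<alpha> * real l / 2 - 1) * real R"
      using R by (simp add: powr_diff)
    also have "K' powr (\<alpha> / 2) * (real R powr (\<alpha> * real l / 2 - 1) * real R) \<le> 
       K' powr (\<alpha> / 2) * (K' powr (- \<alpha> / 2) * real R)"
      using R1[of R] R by (intro mult_left_mono mult_right_mono) auto
    also have "\<dots> = real R" 
    proof -
      have "K' powr (\<alpha> / 2) * K' powr (- \<alpha> / 2) = 1"
        by (simp add: powr_add[symmetric] K'_def)
      then show ?thesis by (simp only: mult.assoc[symmetric] mult_1)
    qed
    finally have "sqrt (4 / (c * \<mu> \<one>)) * (1 + real m) powr (\<alpha> / 2) \<le> sqrt (4 / (c * \<mu> \<one>)) * real R"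
      using c lazy by (intro mult_left_mono) auto
    then show "len (s [^] m) \<le> sqrt (4 / (c * \<mu> \<one>)) * real R"
      using len_power_le[OF \<alpha>, of m] by linarith
  qed
next
  assume crit: "\<alpha> = 2 \<and> l = 1"
  define N where "N = nat \<lceil>max K 1\<rceil>"
  have N: "N \<ge> 1" "K \<le> real N" unfolding N_def by linarith+
  \<comment> \<open>Up to the common factor \<open>1 / (c * \<mu> \<one>)\<close> and with \<open>4 ^ J \<le> 4 * N * R\<close>, the square
      of the critical bound is \<open>256 * 16 ^ J / J \<le> 4096 * N\<^sup>2 * R\<^sup>2 / J\<close>, and this
      is at most \<open>4 * R\<^sup>2\<close> once \<open>J\<close> reaches \<open>J0\<close>.\<close>
  define J0 where "J0 = 1024 * N\<^sup>2"
  show ?thesis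
  proof (intro exI allI impI)
    fix R m :: nat assume R: "4 ^ J0 \<le> R" and m: "real m \<le> K * real R ^ l"
    have R1: "R \<ge> 1" using R by (metis one_le_numeral one_le_power order.trans)
    have "real m \<le> real N * real R" using m crit N(2) mult_right_mono[OF N(2), of "real R"] by simp
    then have mNR: "m \<le> N * R" by (simp flip: of_nat_mult)
    define J where "J = (LEAST j::nat. N * R \<le> 4 ^ j)"
    have ex: "N * R \<le> 4 ^ (N * R)"
      by (rule order.trans[OF less_imp_le[OF less_exp] power_mono]) auto
    have J: "N * R \<le> 4 ^ J" unfolding J_def using ex by (rule LeastI)
    have "R \<le> N * R" using N by simp
    then have "(4::nat) ^ J0 \<le> 4 ^ J" using R J by linarith
    then have JJ0: "J0 \<le> J" by (rule power_le_imp_le_exp[rotated]) simp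
    have J0: "J0 > 0" using N by (simp add: J0_def)
    then have "J > 0" using JJ0 by simp
    have "\<not> N * R \<le> 4 ^ (J - 1)"
      unfolding J_def by (rule not_less_Least) (use \<open>J > 0\<close> in \<open>simp add: J_def\<close>)
    then have "4 * 4 ^ (J - 1) \<le> 4 * (N * R)" by simp
    moreover have "4 * 4 ^ (J - 1) = (4::nat) ^ J" using \<open>J > 0\<close> by (cases J) auto
    ultimately have "(4::nat) ^ J \<le> 4 * (N * R)" by linarith
    then have "real (4 ^ J) \<le> real (4 * (N * R))" by (rule of_nat_mono)
    then have "((4::real) ^ J)\<^sup>2 \<le> (4 * (real N * real R))\<^sup>2" by (intro power_mono) auto
    moreover have "((4::real) ^ J)\<^sup>2 = 16 ^ J" by (simp add: power2_eq_square power_mult_distrib[symmetric])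
    ultimately have pow: "(16::real) ^ J \<le> 16 * (real N)\<^sup>2 * (real R)\<^sup>2" by (simp add: power_mult_distrib)
    have "len (s [^] m) \<le> sqrt (256 * 16 ^ J / (c * \<mu> \<one> * real J))"
      by (rule len_power_le_critical) (use crit mNR J \<open>J > 0\<close> in auto)
    also have "\<dots> \<le> sqrt (4 / (c * \<mu> \<one>) * (real R)\<^sup>2)"
    proof (rule real_sqrt_le_mono)
      have "real J0 \<le> real J" using JJ0 by simp
      then have "1024 * (real N)\<^sup>2 * (real R)\<^sup>2 \<le> real J * (real R)\<^sup>2"
        by (intro mult_right_mono) (auto simp: J0_def)
      then have "256 * 16 ^ J \<le> 4 * (real J * (real R)\<^sup>2)" using pow by linarith
      then have "256 * 16 ^ J / (c * \<mu> \<one> * real J) \<le> 4 * (real J * (real R)\<^sup>2) / (c * \<mu> \<one> * real J)"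
        using c lazy by (intro divide_right_mono) auto
      then show "256 * 16 ^ J / (c * \<mu> \<one> * real J) \<le> 4 / (c * \<mu> \<one>) * (real R)\<^sup>2"
        using \<open>J > 0\<close> by simp
    qed
    also have "\<dots> = sqrt (4 / (c * \<mu> \<one>)) * real R" by (simp only: real_sqrt_mult) simp
    finally show "len (s [^] m) \<le> sqrt (4 / (c * \<mu> \<one>)) * real R" .
  qed
qed

end
end

section \<open>Integer combinations in abelian groups\<close>

context comm_group
begin

definition int_comb :: "'a set \<Rightarrow> ('a \<Rightarrow> int) \<Rightarrow> 'a" where
  "int_comb B c = finprod G (\<lambda>b. b [^] c b) B"

lemma int_independent_iff:
  "int_independent G B \<longleftrightarrow> (\<forall>c. int_comb B c = \<one> \<longrightarrow> (\<forall>b\<in>B. c b = 0))"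
  by (simp add: int_independent_def int_comb_def)

lemma int_comb_closed [simp]: "B \<subseteq> carrier G \<Longrightarrow> int_comb B c \<in> carrier G"
  unfolding int_comb_def by (rule finprod_closed) auto

lemma int_comb_empty [simp]: "int_comb {} c = \<one>"
  by (simp add: int_comb_def)

lemma int_comb_insert:
  "\<lbrakk>finite B; x \<notin> B; insert x B \<subseteq> carrier G\<rbrakk> \<Longrightarrow> int_comb (insert x B) c = x [^] c x \<otimes> int_comb B c"
  unfolding int_comb_def by (rule finprod_insert) auto

lemma int_comb_cong: "\<lbrakk>B \<subseteq> carrier G; \<And>b. b \<in> B \<Longrightarrow> c b = c' b\<rbrakk> \<Longrightarrow> int_comb B c = int_comb B c'"
  unfolding int_comb_def by (rule finprod_cong') auto

lemma int_comb_add: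
  assumes "B \<subseteq> carrier G"
  shows "int_comb B c \<otimes> int_comb B d = int_comb B (\<lambda>b. c b + d b)"
proof -
  have "int_comb B (\<lambda>b. c b + d b) = finprod G (\<lambda>b. b [^] c b \<otimes> b [^] d b) B"
    unfolding int_comb_def by (rule finprod_cong') (use assms in \<open>auto simp: int_pow_mult\<close>)
  also have "\<dots> = int_comb B c \<otimes> int_comb B d"
    unfolding int_comb_def by (rule finprod_multf) (use assms in auto)
  finally show ?thesis by simp
qed

lemma int_comb_pow:
  assumes "finite B" "B \<subseteq> carrier G"
  shows "int_comb B c [^] (m::int) = int_comb B (\<lambda>b. c b * m)"
  using assms
proof (induction B rule: finite_induct)
  case (insert x B)
  then have "int_comb (insert x B) c [^] m = x [^] (c x * m) \<otimes> int_comb B (\<lambda>b. c b * m)"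
    by (simp add: int_comb_insert int_pow_distrib int_pow_pow)
  also have "\<dots> = int_comb (insert x B) (\<lambda>b. c b * m)"
    by (rule int_comb_insert[symmetric]) (use insert in auto)
  finally show ?case .
qed simp

lemma int_comb_zero [simp]: "int_comb B (\<lambda>b. 0) = \<one>"
  by (simp add: int_comb_def)

lemma int_comb_single:
  assumes "finite B" "B \<subseteq> carrier G" "b \<in> B"
  shows "int_comb B (\<lambda>x. if x = b then m else 0) = b [^] m"
proof -
  have "int_comb B (\<lambda>x. if x = b then m else 0) = int_comb (insert b (B - {b})) (\<lambda>x. if x = b then m else 0)"
    using assms by (simp add: insert_absorb)
  also have "\<dots> = b [^] m \<otimes> int_comb (B - {b}) (\<lambda>x. if x = b then m else 0)"
    by (subst int_comb_insert) (use assms in auto)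
  also have "int_comb (B - {b}) (\<lambda>x. if x = b then m else 0) = int_comb (B - {b}) (\<lambda>x. 0)"
    by (rule int_comb_cong) (use assms in auto)
  finally show ?thesis using assms by (simp add: subset_iff)
qed

lemma int_comb_inj:
  assumes B: "B \<subseteq> carrier G" "int_independent G B"
    and eq: "int_comb B c = int_comb B d" and b: "b \<in> B"
  shows "c b = d b"
proof -
  have "int_comb B (\<lambda>b. c b - d b) \<otimes> int_comb B d = int_comb B c"
    by (subst int_comb_add[OF B(1)]) simp
  then have "int_comb B (\<lambda>b. c b - d b) = \<one>"
    using B(1) eq by (metis int_comb_closed r_cancel_one')
  then show ?thesis using B(2) b by (auto simp: int_independent_iff)
qed

lemma generate_eq_int_comb:
  assumes F: "finite F" "F \<subseteq> carrier G" and x: "x \<in> generate G F"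
  shows "\<exists>c. x = int_comb F c"
  using x
proof (induction rule: generate.induct)
  case one
  show ?case by (rule exI[of _ "\<lambda>_. 0"]) simp
next
  case (incl h)
  then have "h = int_comb F (\<lambda>x. if x = h then 1 else 0)"
    using F by (subst int_comb_single) auto
  then show ?case by blast
next
  case (inv h)
  then have "inv h = int_comb F (\<lambda>x. if x = h then - 1 else 0)"
    using F by (subst int_comb_single) (auto simp: int_pow_neg)
  then show ?case by blast
next
  case (eng h1 h2)
  then show ?case using int_comb_add[OF F(2)] by metis
qed

text \<open>A counting argument. If \<open>B\<close> is independent, the combinations of \<open>B\<close> with coefficients in \<open>{0..<M}\<close> are
\<open>M ^ card B\<close> distinct elements; rewritten in terms of \<open>F\<close> they have coefficients \<open>O(M)\<close>, so there are
only \<open>O(M ^ card F)\<close> of them.\<close>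

lemma card_independent_le:
  assumes F: "finite F" "F \<subseteq> carrier G" and gen: "carrier G = generate G F"
    and B: "finite B" "B \<subseteq> carrier G" "int_independent G B"
  shows "card B \<le> card F"
proof (rule ccontr)
  assume less: "\<not> card B \<le> card F"
  have "\<forall>b\<in>B. \<exists>e. b = int_comb F e" using generate_eq_int_comb[OF F] gen B(2) by blast
  then obtain e where e: "\<And>b. b \<in> B \<Longrightarrow> b = int_comb F (e b)" by metis
  define E where "E = (\<Sum>b\<in>B. \<Sum>f\<in>F. nat \<bar>e b f\<bar>)"
  have E: "\<bar>e b f\<bar> \<le> int E" if "b \<in> B" "f \<in> F" for b f
  proof -
    have "nat \<bar>e b f\<bar> \<le> (\<Sum>f\<in>F. nat \<bar>e b f\<bar>)" using that F by (intro member_le_sum) auto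
    also have "\<dots> \<le> E" unfolding E_def using that B by (intro member_le_sum) auto
    finally show ?thesis by simp
  qed
  \<comment> \<open>The comparison of the two counts reads \<open>M ^ card B \<le> (M * L) ^ card F\<close>, so any \<open>M > L ^ card F\<close> is contradictory.\<close>
  define L where "L = 2 * card B * E + 1"
  define M where "M = L ^ card F + 1"
  have M: "M \<ge> 1" by (simp add: M_def)
  have represent: "\<exists>d. (\<forall>f\<in>F. \<bar>d f\<bar> \<le> int (card B' * M * E)) \<and> int_comb B' c = int_comb F d"
    if c: "\<And>b. b \<in> B' \<Longrightarrow> \<bar>c b\<bar> \<le> int M" and B': "B' \<subseteq> B" for B' c
  proof -
    have "finite B'" using B' B by (blast intro: finite_subset)
    then show ?thesis using c B'
    proof (induction B' rule: finite_induct)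
      case empty
      show ?case by (rule exI[of _ "\<lambda>_. 0"]) simp
    next
      case (insert b B')
      then obtain d where d: "\<forall>f\<in>F. \<bar>d f\<bar> \<le> int (card B' * M * E)" "int_comb B' c = int_comb F d" by auto
      have "int_comb (insert b B') c = b [^] c b \<otimes> int_comb B' c"
        using insert B by (intro int_comb_insert) auto
      also have "b [^] c b = int_comb F (\<lambda>f. e b f * c b)"
        using e[of b] insert F int_comb_pow[of F "e b" "c b"] by simp
      finally have "int_comb (insert b B') c = int_comb F (\<lambda>f. e b f * c b + d f)"
        using d F by (simp add: int_comb_add)
      moreover have "\<bar>e b f * c b + d f\<bar> \<le> int (card (insert b B') * M * E)" if f: "f \<in> F" for f
      proof -
        have "\<bar>e b f * c b\<bar> \<le> int E * int M"
          unfolding abs_mult using E[of b f] insert f by (intro mult_mono) auto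
        then have "\<bar>e b f * c b + d f\<bar> \<le> int E * int M + int (card B' * M * E)"
          using bspec[OF d(1) f] by linarith
        then show ?thesis using insert.hyps by (simp add: algebra_simps)
      qed
      ultimately show ?case by (intro exI[of _ "\<lambda>f. e b f * c b + d f"]) auto
    qed
  qed
  define N where "N = card B * M * E"
  let ?P = "PiE B (\<lambda>_. {0..<int M})" and ?T = "PiE F (\<lambda>_. {- int N..int N})"
  have sub: "int_comb B ` ?P \<subseteq> int_comb F ` ?T"
  proof
    fix x assume "x \<in> int_comb B ` ?P"
    then obtain c where c: "c \<in> ?P" "x = int_comb B c" by auto
    have "\<bar>c b\<bar> \<le> int M" if "b \<in> B" for b
    proof -
      have "c b \<in> {0..<int M}" using c(1) that by (rule PiE_mem)
      then show ?thesis by auto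
    qed
    then obtain d where d: "\<forall>f\<in>F. \<bar>d f\<bar> \<le> int N" "x = int_comb F d"
      using represent[of B c] c by (auto simp: N_def)
    have "int_comb F d = int_comb F (restrict d F)" by (rule int_comb_cong) (use F in auto)
    moreover have "restrict d F \<in> ?T" using d(1) by (fastforce simp: abs_le_iff)
    ultimately show "x \<in> int_comb F ` ?T" using d(2) by blast
  qed
  have inj: "inj_on (int_comb B) ?P"
  proof (rule inj_onI)
    fix c d assume cd: "c \<in> ?P" "d \<in> ?P" "int_comb B c = int_comb B d"
    show "c = d"
      using cd(1,2) by (rule PiE_ext) (rule int_comb_inj[OF B(2,3) cd(3)])
  qed
  have fin: "finite ?T" using F by (intro finite_PiE) auto
  have "card ?P \<le> card ?T"
    using card_image[OF inj] card_mono[OF finite_imageI[OF fin] sub]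
      card_image_le[OF fin, of "int_comb F"] by linarith
  then have "M ^ card B \<le> (2 * N + 1) ^ card F"
    using B F by (simp add: card_PiE nat_add_distrib nat_mult_distrib)
  also have "2 * N + 1 \<le> M * L" using M by (simp add: N_def L_def algebra_simps)
  then have "(2 * N + 1) ^ card F \<le> (M * L) ^ card F" by (rule power_mono) simp
  finally have "M ^ card B \<le> M ^ card F * L ^ card F" by (simp add: power_mult_distrib)
  moreover have "M ^ card F * M \<le> M ^ card B"
    using power_increasing[of "Suc (card F)" "card B" M] less M by (simp add: mult.commute)
  ultimately have "M ^ card F * M \<le> M ^ card F * L ^ card F" by linarith
  then have "M \<le> L ^ card F" using M by simp
  then show False by (simp add: M_def)
qed

text \<open>The rank is defined by a supremum of natural numbers, which is attained because the cardinalities of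
independent sets are bounded by the number of generators.\<close>

lemma ex_maximal_independent:
  assumes F: "finite F" "F \<subseteq> carrier G" and gen: "carrier G = generate G F"
  shows "\<exists>B. finite B \<and> B \<subseteq> carrier G \<and> int_independent G B \<and> card B = torsion_free_rank G"
    and "\<lbrakk>finite B; B \<subseteq> carrier G; int_independent G B\<rbrakk> \<Longrightarrow> card B \<le> torsion_free_rank G"
proof -
  let ?X = "{card B | B. finite B \<and> B \<subseteq> carrier G \<and> int_independent G B}"
  have "?X \<subseteq> {..card F}" using card_independent_le[OF assms] by auto
  then have fin: "finite ?X" by (rule finite_subset) simp
  have "card {} \<in> ?X" by (rule CollectI, rule exI[of _ "{}"]) (simp add: int_independent_iff)
  then have "?X \<noteq> {}" by blast
  then have Max_in: "Max ?X \<in> ?X" using Max_in[OF fin] by blast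
  have Max: "torsion_free_rank G = Max ?X"
    unfolding torsion_free_rank_def Sup_nat_def if_not_P[OF \<open>?X \<noteq> {}\<close>] by (rule refl)
  then show "\<exists>B. finite B \<and> B \<subseteq> carrier G \<and> int_independent G B \<and> card B = torsion_free_rank G"
    using Max_in unfolding Max mem_Collect_eq by metis
  assume "finite B" "B \<subseteq> carrier G" "int_independent G B"
  then have "card B \<in> ?X" by blast
  then show "card B \<le> torsion_free_rank G" using fin Max by simp
qed

text \<open>Steinitz exchange: a relation between \<open>x\<close> and a maximal independent set involves some member \<open>b\<close> of it with
nonzero coefficient, because \<open>x\<close> has infinite order, and \<open>x\<close> can take the place of \<open>b\<close>.\<close>

lemma ex_maximal_independent_containing:
  assumes F: "finite F" "F \<subseteq> carrier G" and gen: "carrier G = generate G F"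
    and x: "x \<in> carrier G" and inf: "\<And>m::int. x [^] m = \<one> \<Longrightarrow> m = 0"
  shows "\<exists>B. finite B \<and> B \<subseteq> carrier G \<and> int_independent G B \<and> card B = torsion_free_rank G \<and> x \<in> B"
proof -
  obtain B where B: "finite B" "B \<subseteq> carrier G" "int_independent G B" "card B = torsion_free_rank G"
    using ex_maximal_independent(1)[OF F gen] by blast
  show ?thesis
  proof (cases "x \<in> B")
    case True
    then show ?thesis using B by blast
  next
    case False
    have "\<not> int_independent G (insert x B)"
      using ex_maximal_independent(2)[OF F gen, of "insert x B"] B x False by auto
    then obtain c where c: "int_comb (insert x B) c = \<one>" "\<not> (\<forall>b\<in>insert x B. c b = 0)"
      by (auto simp: int_independent_iff)
    have rel: "x [^] c x \<otimes> int_comb B c = \<one>"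
      using c(1) B x False by (simp add: int_comb_insert)
    have cx: "c x \<noteq> 0"
    proof
      assume "c x = 0"
      then have "int_comb B c = \<one>" using rel B x by simp
      then show False using B(3) c(2) \<open>c x = 0\<close> by (auto simp: int_independent_iff)
    qed
    obtain b where b: "b \<in> B" "c b \<noteq> 0"
    proof (cases "\<forall>b\<in>B. c b = 0")
      case True
      then have "int_comb B c = int_comb B (\<lambda>_. 0)" using B by (intro int_comb_cong) auto
      then have "x [^] c x = \<one>" using rel x by simp
      then show ?thesis using inf cx by blast
    qed auto
    define B' where "B' = insert x (B - {b})"
    have B': "finite B'" "B' \<subseteq> carrier G" "card B' = card B" "x \<in> B'"
      using B x b False card_Suc_Diff1[OF B(1) b(1)] by (auto simp: B'_def)
    have xc: "x [^] c x = int_comb B (\<lambda>b. - c b)"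
    proof -
      have "int_comb B (\<lambda>b. - c b) \<otimes> int_comb B c = \<one>"
        using B by (simp add: int_comb_add)
      then show ?thesis using rel B x by (metis int_comb_closed int_pow_closed right_cancel)
    qed
    have "int_independent G B'"
      unfolding int_independent_iff
    proof (intro allI impI)
      fix d assume d: "int_comb B' d = \<one>"
      let ?d = "\<lambda>y. if y = b then 0 else d y"
      have "x [^] d x \<otimes> int_comb (B - {b}) d = \<one>"
        using d B x False unfolding B'_def by (subst (asm) int_comb_insert) auto
      moreover have "int_comb (B - {b}) d = int_comb B ?d"
      proof -
        have "int_comb B ?d = int_comb (insert b (B - {b})) ?d" using b by (simp add: insert_absorb)
        also have "\<dots> = b [^] (0::int) \<otimes> int_comb (B - {b}) ?d"
          by (subst int_comb_insert) (use B b in auto)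
        also have "\<dots> = int_comb (B - {b}) ?d" using B by (simp add: subset_iff)
        also have "\<dots> = int_comb (B - {b}) d" by (rule int_comb_cong) (use B in auto)
        finally show ?thesis by simp
      qed
      ultimately have "(x [^] d x \<otimes> int_comb B ?d) [^] c x = \<one>" by (simp only: int_pow_one)
      then have "(x [^] c x) [^] d x \<otimes> int_comb B ?d [^] c x = \<one>"
      proof -
        have "(x [^] d x) [^] c x = (x [^] c x) [^] d x"
          using x by (simp only: int_pow_pow mult.commute)
        then show ?thesis
          using \<open>(x [^] d x \<otimes> int_comb B ?d) [^] c x = \<one>\<close> x int_comb_closed[OF B(2), of ?d]
          by (simp only: int_pow_distrib int_pow_closed)
      qed
      then have comb: "int_comb B (\<lambda>y. - c y * d x + ?d y * c x) = \<one>"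
        using B by (simp add: xc int_comb_pow int_comb_add)
      have zero: "- c y * d x + ?d y * c x = 0" if "y \<in> B" for y
        using bspec[OF spec[OF iffD1[OF int_independent_iff B(3)], THEN mp, OF comb] that] .
      have "d x = 0" using zero[OF b(1)] b(2) by simp
      moreover have "d y = 0" if "y \<in> B - {b}" for y
        using zero[of y] that \<open>d x = 0\<close> cx by auto
      ultimately show "\<forall>y\<in>B'. d y = 0" by (auto simp: B'_def)
    qed
    then show ?thesis using B' B(4) by (intro exI[of _ B']) simp
  qed
qed

end

section \<open>The lower central series\<close>

text \<open>The recursion equation would unfold \<open>lower_central G (Suc (Suc j))\<close> whenever it occurs; only membership facts are needed.\<close>

declare lower_central.simps(3) [simp del]

context group
begin

definition commutator :: "'a \<Rightarrow> 'a \<Rightarrow> 'a" where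
  "commutator h k = h \<otimes> k \<otimes> inv h \<otimes> inv k"

lemma commutator_closed [simp]:
  "\<lbrakk>h \<in> carrier G; k \<in> carrier G\<rbrakk> \<Longrightarrow> commutator h k \<in> carrier G"
  by (simp add: commutator_def)

text \<open>Together with the next identity, this is bilinearity of the commutator up to an iterated commutator,
which lies one step deeper in the lower central series.\<close>

lemma commutator_mult_left:
  assumes "h \<in> carrier G" "h' \<in> carrier G" "k \<in> carrier G"
  shows "commutator (h \<otimes> h') k = commutator h (commutator h' k) \<otimes> (commutator h' k \<otimes> commutator h k)"
  using assms by (simp add: commutator_def m_assoc inv_mult_group)

lemma commutator_mult_right:
  assumes "h \<in> carrier G" "k \<in> carrier G" "k' \<in> carrier G"
  shows "commutator h (k \<otimes> k') = commutator h k \<otimes> (commutator k (commutator h k') \<otimes> commutator h k')"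
  using assms by (simp add: commutator_def m_assoc inv_mult_group)

lemma commutator_conj:
  assumes "h \<in> carrier G" "k \<in> carrier G" "g \<in> carrier G"
  shows "g \<otimes> commutator h k \<otimes> inv g = commutator (g \<otimes> h \<otimes> inv g) (g \<otimes> k \<otimes> inv g)"
  using assms by (simp add: commutator_def m_assoc inv_mult_group)

lemma commutator_subgroup_eq:
  "commutator_subgroup G H K = generate G {commutator h k | h k. h \<in> H \<and> k \<in> K}"
  by (simp add: commutator_subgroup_def commutator_def)

lemma lower_central_Suc:
  "1 \<le> j \<Longrightarrow> lower_central G (Suc j) =
     generate G {commutator h k | h k. h \<in> carrier G \<and> k \<in> lower_central G j}"
  by (cases j) (auto simp: commutator_subgroup_eq lower_central.simps(3))

lemma normal_lower_central: "lower_central G j \<lhd> G"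
proof (induction j)
  case 0
  show ?case by (simp add: normal_self)
next
  case (Suc j)
  show ?case
  proof (cases "j = 0")
    case True
    then show ?thesis by (simp add: normal_self)
  next
    case False
    interpret K: normal "lower_central G j" G by fact
    have "generate G {commutator h k | h k. h \<in> carrier G \<and> k \<in> lower_central G j} \<lhd> G"
    proof (rule normal_generateI)
      show "{commutator h k | h k. h \<in> carrier G \<and> k \<in> lower_central G j} \<subseteq> carrier G"
        using K.subset by auto
      fix x g assume x: "x \<in> {commutator h k | h k. h \<in> carrier G \<and> k \<in> lower_central G j}"
        and g: "g \<in> carrier G"
      then obtain h k where hk: "x = commutator h k" "h \<in> carrier G" "k \<in> lower_central G j" by auto
      have "g \<otimes> x \<otimes> inv g = commutator (g \<otimes> h \<otimes> inv g) (g \<otimes> k \<otimes> inv g)"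
        using hk g K.subset by (simp add: commutator_conj subset_iff)
      moreover have "g \<otimes> k \<otimes> inv g \<in> lower_central G j" using hk g by (simp add: K.inv_op_closed2)
      ultimately show "g \<otimes> x \<otimes> inv g \<in> {commutator h k | h k. h \<in> carrier G \<and> k \<in> lower_central G j}"
        using hk g by blast
    qed
    then show ?thesis using False by (simp add: lower_central_Suc)
  qed
qed

lemma subgroup_lower_central: "subgroup (lower_central G j) G"
  using normal_lower_central by (rule normal_imp_subgroup)

lemma lower_central_carrier: "x \<in> lower_central G j \<Longrightarrow> x \<in> carrier G"
  using subgroup.subset[OF subgroup_lower_central] by blast

lemma commutator_in_lower_central:
  "\<lbrakk>1 \<le> j; h \<in> carrier G; k \<in> lower_central G j\<rbrakk> \<Longrightarrow> commutator h k \<in> lower_central G (Suc j)"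
  by (auto simp: lower_central_Suc intro!: generate.incl)

lemma lower_central_Suc_subset: "lower_central G (Suc j) \<subseteq> lower_central G j"
proof (cases "j = 0")
  case False
  interpret K: normal "lower_central G j" G by (rule normal_lower_central)
  have "commutator h k \<in> lower_central G j" if "h \<in> carrier G" "k \<in> lower_central G j" for h k
  proof -
    have "h \<otimes> k \<otimes> inv h \<in> lower_central G j" using that by (simp add: K.inv_op_closed2)
    then show ?thesis unfolding commutator_def by (rule K.m_closed[OF _ K.m_inv_closed[OF that(2)]])
  qed
  then have "generate G {commutator h k | h k. h \<in> carrier G \<and> k \<in> lower_central G j} \<subseteq> lower_central G j"
    by (intro generate_subgroup_incl subgroup_lower_central) auto
  then show ?thesis using False by (simp add: lower_central_Suc)
qed simp

lemma lower_central_antimono: "i \<le> j \<Longrightarrow> lower_central G j \<subseteq> lower_central G i"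
  by (rule lift_Suc_antimono_le[of "lower_central G"]) (rule lower_central_Suc_subset)

abbreviation layer :: "nat \<Rightarrow> 'a set monoid" where
  "layer j \<equiv> lower_central_quotient G j"

definition layer_class :: "nat \<Rightarrow> 'a \<Rightarrow> 'a set" where
  "layer_class j x = lower_central G (Suc j) #> x"

abbreviation lower_central_group :: "nat \<Rightarrow> ('a, 'b) monoid_scheme" where
  "lower_central_group j \<equiv> G\<lparr>carrier := lower_central G j\<rparr>"

lemma group_lower_central_group: "group (lower_central_group j)"
  using subgroup_lower_central by (rule subgroup_imp_group)

lemma normal_in_layer: "lower_central G (Suc j) \<lhd> lower_central_group j"
  using subgroup_lower_central normal_lower_central lower_central_Suc_subset
  by (rule normal_restrict_supergroup)

lemma group_layer: "group (layer j)"
  unfolding lower_central_quotient_def by (rule normal.factorgroup_is_group[OF normal_in_layer])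

lemma layer_class_hom: "layer_class j \<in> hom (lower_central_group j) (layer j)"
proof -
  have "layer_class j = (\<lambda>x. r_coset (lower_central_group j) (lower_central G (Suc j)) x)"
    by (simp add: layer_class_def r_coset_def fun_eq_iff)
  then show ?thesis
    unfolding lower_central_quotient_def using normal.r_coset_hom_Mod[OF normal_in_layer[of j]] by simp
qed

lemma carrier_layer: "carrier (layer j) = layer_class j ` lower_central G j"
  by (auto simp: lower_central_quotient_def carrier_FactGroup layer_class_def r_coset_def)

lemma layer_class_closed [simp]: "x \<in> lower_central G j \<Longrightarrow> layer_class j x \<in> carrier (layer j)"
  by (simp add: carrier_layer)

lemma layer_class_mult:
  "\<lbrakk>x \<in> lower_central G j; y \<in> lower_central G j\<rbrakk> \<Longrightarrow>
    layer_class j (x \<otimes> y) = layer_class j x \<otimes>\<^bsub>layer j\<^esub> layer_class j y"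
  using hom_mult[OF layer_class_hom[of j]] by simp

lemma group_hom_layer_class: "group_hom (lower_central_group j) (layer j) (layer_class j)"
  by (simp add: group_hom_def group_hom_axioms_def group_lower_central_group group_layer layer_class_hom)

lemma layer_class_one [simp]: "layer_class j \<one> = \<one>\<^bsub>layer j\<^esub>"
  using group_hom.hom_one[OF group_hom_layer_class[of j]] by simp

lemma layer_class_int_pow:
  assumes "x \<in> lower_central G j"
  shows "layer_class j (x [^] (m::int)) = layer_class j x [^]\<^bsub>layer j\<^esub> m"
  using group_hom.hom_int_pow[OF group_hom_layer_class[of j], of x m] assms
    int_pow_consistent[OF subgroup_lower_central assms] by simp

lemma layer_class_eq_iff:
  assumes "x \<in> carrier G" "y \<in> carrier G"
  shows "layer_class j x = layer_class j y \<longleftrightarrow> x \<otimes> inv y \<in> lower_central G (Suc j)"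
proof
  assume "layer_class j x = layer_class j y"
  then have "x \<in> lower_central G (Suc j) #> y"
    using rcos_self[OF assms(1) subgroup_lower_central, of "Suc j"] by (simp add: layer_class_def)
  then obtain h where "h \<in> lower_central G (Suc j)" "x = h \<otimes> y" by (auto simp: r_coset_def)
  then show "x \<otimes> inv y \<in> lower_central G (Suc j)"
    using assms by (simp add: m_assoc lower_central_carrier)
next
  assume *: "x \<otimes> inv y \<in> lower_central G (Suc j)"
  have "x = (x \<otimes> inv y) \<otimes> y" using assms by (simp add: m_assoc)
  then have "x \<in> lower_central G (Suc j) #> y" using * by (auto simp: r_coset_def)
  then show "layer_class j x = layer_class j y"
    unfolding layer_class_def by (rule repr_independence[OF _ assms(2) subgroup_lower_central, symmetric])
qed

lemma layer_class_eq_one_iff: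
  "x \<in> carrier G \<Longrightarrow> layer_class j x = \<one>\<^bsub>layer j\<^esub> \<longleftrightarrow> x \<in> lower_central G (Suc j)"
  using layer_class_eq_iff[of x \<one> j] by simp

lemma comm_group_layer:
  assumes j: "1 \<le> j"
  shows "comm_group (layer j)"
proof (rule group.group_comm_groupI[OF group_layer])
  fix X Y assume "X \<in> carrier (layer j)" "Y \<in> carrier (layer j)"
  then obtain x y where xy: "x \<in> lower_central G j" "y \<in> lower_central G j"
    and XY: "X = layer_class j x" "Y = layer_class j y" by (auto simp: carrier_layer)
  have c: "x \<in> carrier G" "y \<in> carrier G" using xy by (auto intro: lower_central_carrier)
  have "(x \<otimes> y) \<otimes> inv (y \<otimes> x) = commutator x y"
    using c by (simp add: commutator_def m_assoc inv_mult_group)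
  then have "layer_class j (x \<otimes> y) = layer_class j (y \<otimes> x)"
    using c xy j by (subst layer_class_eq_iff) (auto intro: commutator_in_lower_central)
  then show "X \<otimes>\<^bsub>layer j\<^esub> Y = Y \<otimes>\<^bsub>layer j\<^esub> X"
    using xy XY by (simp add: layer_class_mult)
qed

text \<open>
The iterated commutator in \<open>commutator_mult_left\<close> vanishes in layer \<open>Suc j\<close>; the remaining factors commute there.
\<close>

lemma commutator_class_mult_left:
  assumes j: "1 \<le> j" and "h \<in> carrier G" "h' \<in> carrier G" and k: "k \<in> lower_central G j"
  shows "layer_class (Suc j) (commutator (h \<otimes> h') k) =
    layer_class (Suc j) (commutator h k) \<otimes>\<^bsub>layer (Suc j)\<^esub> layer_class (Suc j) (commutator h' k)"
proof -
  interpret L: comm_group "layer (Suc j)" by (rule comm_group_layer) simp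
  have in_j: "commutator h k \<in> lower_central G (Suc j)" "commutator h' k \<in> lower_central G (Suc j)"
    using assms by (auto intro: commutator_in_lower_central)
  have deep: "commutator h (commutator h' k) \<in> lower_central G (Suc (Suc j))"
    using assms in_j by (auto intro: commutator_in_lower_central)
  have kc: "k \<in> carrier G" using k by (rule lower_central_carrier)
  have "layer_class (Suc j) (commutator (h \<otimes> h') k) =
      layer_class (Suc j) (commutator h (commutator h' k)) \<otimes>\<^bsub>layer (Suc j)\<^esub>
      (layer_class (Suc j) (commutator h' k) \<otimes>\<^bsub>layer (Suc j)\<^esub> layer_class (Suc j) (commutator h k))"
    using assms kc in_j deep lower_central_Suc_subset[of "Suc j"]
    by (simp add: commutator_mult_left layer_class_mult subgroup.m_closed[OF subgroup_lower_central] subsetD)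
  also have "layer_class (Suc j) (commutator h (commutator h' k)) = \<one>\<^bsub>layer (Suc j)\<^esub>"
    using deep by (subst layer_class_eq_one_iff) (auto intro: lower_central_carrier)
  finally show ?thesis using in_j by (simp add: L.m_comm)
qed

lemma commutator_class_mult_right:
  assumes j: "1 \<le> j" and "h \<in> carrier G" and k: "k \<in> lower_central G j" "k' \<in> lower_central G j"
  shows "layer_class (Suc j) (commutator h (k \<otimes> k')) =
    layer_class (Suc j) (commutator h k) \<otimes>\<^bsub>layer (Suc j)\<^esub> layer_class (Suc j) (commutator h k')"
proof -
  interpret L: comm_group "layer (Suc j)" by (rule comm_group_layer) simp
  have in_j: "commutator h k \<in> lower_central G (Suc j)" "commutator h k' \<in> lower_central G (Suc j)"
    using assms by (auto intro: commutator_in_lower_central)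
  have kc: "k \<in> carrier G" "k' \<in> carrier G" using k by (auto intro: lower_central_carrier)
  have deep: "commutator k (commutator h k') \<in> lower_central G (Suc (Suc j))"
    using assms in_j kc by (auto intro: commutator_in_lower_central)
  have "layer_class (Suc j) (commutator h (k \<otimes> k')) =
      layer_class (Suc j) (commutator h k) \<otimes>\<^bsub>layer (Suc j)\<^esub>
      (layer_class (Suc j) (commutator k (commutator h k')) \<otimes>\<^bsub>layer (Suc j)\<^esub> layer_class (Suc j) (commutator h k'))"
    using assms kc in_j deep lower_central_Suc_subset[of "Suc j"]
    by (simp add: commutator_mult_right layer_class_mult subgroup.m_closed[OF subgroup_lower_central] subsetD)
  also have "layer_class (Suc j) (commutator k (commutator h k')) = \<one>\<^bsub>layer (Suc j)\<^esub>"
    using deep by (subst layer_class_eq_one_iff) (auto intro: lower_central_carrier)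
  finally show ?thesis using in_j by simp
qed

lemma group_hom_commutator_left:
  assumes j: "1 \<le> j" and k: "k \<in> lower_central G j"
  shows "group_hom G (layer (Suc j)) (\<lambda>h. layer_class (Suc j) (commutator h k))"
  unfolding group_hom_def group_hom_axioms_def
  using assms by (auto simp: group_layer commutator_class_mult_left commutator_in_lower_central intro!: homI)

lemma group_hom_commutator_right:
  assumes j: "1 \<le> j" and h: "h \<in> carrier G"
  shows "group_hom (lower_central_group j) (layer (Suc j)) (\<lambda>k. layer_class (Suc j) (commutator h k))"
  unfolding group_hom_def group_hom_axioms_def
  using assms by (auto simp: group_layer group_lower_central_group commutator_class_mult_right
      commutator_in_lower_central intro!: homI)

text \<open>By bilinearity and because commutators with \<open>lower_central G (Suc j)\<close> vanish in layer \<open>Suc j\<close>. Hence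
the right argument of the commutator may be replaced by any representative of its class.\<close>

lemma commutator_class_cong:
  assumes j: "1 \<le> j" and h: "h \<in> carrier G" and k: "k \<in> lower_central G j" "k' \<in> lower_central G j"
    and eq: "layer_class j k = layer_class j k'"
  shows "layer_class (Suc j) (commutator h k) = layer_class (Suc j) (commutator h k')"
proof -
  interpret L: comm_group "layer (Suc j)" by (rule comm_group_layer) simp
  have kc: "k \<in> carrier G" "k' \<in> carrier G" using k by (auto intro: lower_central_carrier)
  define z where "z = k \<otimes> inv k'"
  have z: "z \<in> lower_central G (Suc j)" using eq kc by (simp add: z_def layer_class_eq_iff)
  then have zj: "z \<in> lower_central G j" using lower_central_Suc_subset by blast
  have "commutator h z \<in> lower_central G (Suc (Suc j))"
    using z h by (auto intro: commutator_in_lower_central)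
  then have "layer_class (Suc j) (commutator h z) = \<one>\<^bsub>layer (Suc j)\<^esub>"
    by (subst layer_class_eq_one_iff) (auto intro: lower_central_carrier)
  moreover have "k = z \<otimes> k'" using kc by (simp add: z_def m_assoc)
  ultimately show ?thesis
    using commutator_class_mult_right[OF j h zj k(2)] commutator_in_lower_central[OF j h k(2)] by simp
qed

text \<open>Layer \<open>Suc j\<close> is generated by the commutators of generators of \<open>G\<close> with generators of layer \<open>j\<close>, by
bilinearity in the left argument and then in the right one.\<close>

lemma layer_finitely_generated:
  assumes S: "finite S" "S \<subseteq> carrier G" "generate G S = carrier G" and j: "1 \<le> j"
  shows "\<exists>F. finite F \<and> F \<subseteq> lower_central G j \<and> carrier (layer j) = generate (layer j) (layer_class j ` F)"
  using j
proof (induction j rule: dec_induct)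
  case base
  have "generate (layer 1) (layer_class 1 ` S) = layer_class 1 ` generate (lower_central_group 1) S"
    using S by (intro group_hom.generate_img[OF group_hom_layer_class]) auto
  also have "\<dots> = carrier (layer 1)" using S by (simp add: carrier_layer)
  finally show ?case using S by (intro exI[of _ S]) auto
next
  case (step j)
  then obtain F where F: "finite F" "F \<subseteq> lower_central G j"
    "carrier (layer j) = generate (layer j) (layer_class j ` F)" by auto
  define F' where "F' = (\<lambda>(s, f). commutator s f) ` (S \<times> F)"
  have F': "finite F'" "F' \<subseteq> lower_central G (Suc j)"
    using S F step.hyps by (auto simp: F'_def intro!: commutator_in_lower_central)
  interpret L: group "layer (Suc j)" by (rule group_layer)
  let ?T = "generate (layer (Suc j)) (layer_class (Suc j) ` F')"
  have F'_sub: "layer_class (Suc j) ` F' \<subseteq> carrier (layer (Suc j))" using F' by auto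
  then have T: "subgroup ?T (layer (Suc j))" by (rule L.generate_is_subgroup)
  have gens: "layer_class (Suc j) (commutator h f) \<in> ?T" if h: "h \<in> carrier G" and f: "f \<in> F" for h f
  proof -
    interpret \<phi>: group_hom G "layer (Suc j)" "\<lambda>h. layer_class (Suc j) (commutator h f)"
      using group_hom_commutator_left F f step.hyps by auto
    have "layer_class (Suc j) (commutator h f) \<in> (\<lambda>h. layer_class (Suc j) (commutator h f)) ` generate G S"
      using h S by auto
    also have "\<dots> = generate (layer (Suc j)) ((\<lambda>h. layer_class (Suc j) (commutator h f)) ` S)"
      using \<phi>.generate_img[OF S(2)] by simp
    also have "\<dots> \<subseteq> ?T" by (rule L.mono_generate) (use f in \<open>auto simp: F'_def\<close>)
    finally show ?thesis .
  qed
  have comms: "layer_class (Suc j) (commutator h k) \<in> ?T" if h: "h \<in> carrier G" and k: "k \<in> lower_central G j" for h k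
  proof -
    interpret \<psi>: group_hom "lower_central_group j" "layer (Suc j)" "\<lambda>k. layer_class (Suc j) (commutator h k)"
      using group_hom_commutator_right h step.hyps by auto
    have F_sub: "F \<subseteq> carrier (lower_central_group j)" using F by simp
    have "layer_class j k \<in> generate (layer j) (layer_class j ` F)"
      using layer_class_closed[OF k] unfolding F(3) .
    also have "\<dots> = layer_class j ` generate (lower_central_group j) F"
      by (rule group_hom.generate_img[OF group_hom_layer_class F_sub])
    finally obtain k' where k': "k' \<in> generate (lower_central_group j) F" "layer_class j k = layer_class j k'"
      by auto
    have "k' \<in> lower_central G j"
      using group.generate_in_carrier[OF group_lower_central_group F_sub k'(1)] by simp
    then have "layer_class (Suc j) (commutator h k) = layer_class (Suc j) (commutator h k')"
      using commutator_class_cong[OF _ h k _ k'(2)] step.hyps by simp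
    also have "\<dots> \<in> (\<lambda>k. layer_class (Suc j) (commutator h k)) ` generate (lower_central_group j) F"
      using k'(1) by auto
    also have "\<dots> = generate (layer (Suc j)) ((\<lambda>k. layer_class (Suc j) (commutator h k)) ` F)"
      using \<psi>.generate_img[OF F_sub] by simp
    also have "\<dots> \<subseteq> ?T"
      by (rule L.generate_subgroup_incl[OF _ T]) (use gens[OF h] in \<open>simp add: image_subset_iff\<close>)
    finally show ?thesis .
  qed
  let ?C = "{commutator h k | h k. h \<in> carrier G \<and> k \<in> lower_central G j}"
  have C_sub: "?C \<subseteq> lower_central G (Suc j)" using step.hyps by (auto intro: commutator_in_lower_central)
  have "carrier (layer (Suc j)) = layer_class (Suc j) ` generate G ?C"
    using step.hyps by (simp add: carrier_layer lower_central_Suc[of j])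
  also have "generate G ?C = generate (lower_central_group (Suc j)) ?C"
    by (rule generate_consistent[OF C_sub subgroup_lower_central, symmetric])
  also have "layer_class (Suc j) ` \<dots> = generate (layer (Suc j)) (layer_class (Suc j) ` ?C)"
    by (rule group_hom.generate_img[OF group_hom_layer_class, symmetric]) (use C_sub in simp)
  also have "\<dots> \<subseteq> ?T"
    by (rule L.generate_subgroup_incl[OF _ T]) (clarify, rule comms)
  finally have "carrier (layer (Suc j)) = ?T" using subgroup.subset[OF T] by (rule equalityI)
  then show ?case using F' by (intro exI[of _ F'] conjI)
qed

end

section \<open>Balls of a length function on a nilpotent group\<close>

context group_length
begin

lemma len_pow_le: "x \<in> carrier G \<Longrightarrow> len (x [^] (m::nat)) \<le> real m * len x"
proof (induction m)
  case (Suc m)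
  then have "len (x [^] Suc m) \<le> len (x [^] m) + len x" by (simp add: len_mult)
  also have "\<dots> \<le> real m * len x + len x" using Suc by simp
  also have "\<dots> = real (Suc m) * len x" by (simp add: distrib_right)
  finally show ?case .
qed (simp add: len_one)

lemma len_int_pow_le: 
  assumes "x \<in> carrier G"
  shows "len (x [^] (m::int)) \<le> real_of_int \<bar>m\<bar> * len x"
proof (cases m rule: int_cases2)
  case (nonneg n)
  then show ?thesis using len_pow_le[OF assms, of n] by (simp add: int_pow_int)
next
  case (nonpos n)
  then show ?thesis using len_pow_le[OF assms, of n] assms by (simp add: int_pow_neg_int len_inv)
qed

lemma len_commutator_le:
  assumes "h \<in> carrier G" "k \<in> carrier G"
  shows "len (commutator h k) \<le> 2 * len h + 2 * len k"
proof -
  have "len (commutator h k) \<le> len (h \<otimes> k \<otimes> inv h) + len (inv k)"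
    unfolding commutator_def using assms by (intro len_mult) auto
  also have "len (h \<otimes> k \<otimes> inv h) \<le> len (h \<otimes> k) + len (inv h)" using assms by (intro len_mult) auto
  also have "len (h \<otimes> k) \<le> len h + len k" using assms by (intro len_mult) auto
  finally show ?thesis using assms by (simp add: len_inv)
qed

text \<open>Distortion of \<open>x\<close> in the lower central series, up to the next term of the series: it takes length \<open>O(R)\<close> to
represent the powers with exponent up to \<open>R ^ j\<close>. Working modulo the next term makes the induction on \<open>j\<close> elementary.\<close>

definition short_powers :: "nat \<Rightarrow> 'a \<Rightarrow> bool" where
  "short_powers j x \<longleftrightarrow> (\<exists>C\<ge>0. \<forall>(R::nat)\<ge>1. \<forall>m::int. \<bar>m\<bar> \<le> int R ^ j \<longrightarrow>
     (\<exists>g\<in>lower_central G j. layer_class j g = layer_class j x [^]\<^bsub>layer j\<^esub> m \<and> len g \<le> C * real R))"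

lemma short_powers_mult:
  assumes j: "1 \<le> j" and x: "x \<in> lower_central G j" and y: "y \<in> lower_central G j"
    and sx: "short_powers j x" and sy: "short_powers j y"
  shows "short_powers j (x \<otimes> y)"
proof -
  interpret L: comm_group "layer j" by (rule comm_group_layer[OF j])
  obtain C where C: "C \<ge> 0" "\<And>R m. \<lbrakk>R \<ge> 1; \<bar>m\<bar> \<le> int R ^ j\<rbrakk> \<Longrightarrow>
     \<exists>g\<in>lower_central G j. layer_class j g = layer_class j x [^]\<^bsub>layer j\<^esub> m \<and> len g \<le> C * real R"
    using sx unfolding short_powers_def by blast
  obtain D where D: "D \<ge> 0" "\<And>R m. \<lbrakk>R \<ge> 1; \<bar>m\<bar> \<le> int R ^ j\<rbrakk> \<Longrightarrow>
     \<exists>g\<in>lower_central G j. layer_class j g = layer_class j y [^]\<^bsub>layer j\<^esub> m \<and> len g \<le> D * real R"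
    using sy unfolding short_powers_def by blast
  show ?thesis
    unfolding short_powers_def
  proof (intro exI[of _ "C + D"] conjI allI impI)
    show "0 \<le> C + D" using C D by simp
    fix R :: nat and m :: int assume R: "1 \<le> R" "\<bar>m\<bar> \<le> int R ^ j"
    obtain g where g: "g \<in> lower_central G j" "layer_class j g = layer_class j x [^]\<^bsub>layer j\<^esub> m" "len g \<le> C * real R"
      using C(2)[OF R] by blast
    obtain h where h: "h \<in> lower_central G j" "layer_class j h = layer_class j y [^]\<^bsub>layer j\<^esub> m" "len h \<le> D * real R"
      using D(2)[OF R] by blast
    show "\<exists>g\<in>lower_central G j. layer_class j g = layer_class j (x \<otimes> y) [^]\<^bsub>layer j\<^esub> m \<and> len g \<le> (C + D) * real R"
    proof (intro bexI conjI)
      show "layer_class j (g \<otimes> h) = layer_class j (x \<otimes> y) [^]\<^bsub>layer j\<^esub> m"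
        using x y g h by (simp add: layer_class_mult L.int_pow_distrib)
      have "len (g \<otimes> h) \<le> len g + len h" using g h by (intro len_mult lower_central_carrier)
      then show "len (g \<otimes> h) \<le> (C + D) * real R" using g h by (simp add: algebra_simps)
      show "g \<otimes> h \<in> lower_central G j" using g h by (simp add: subgroup.m_closed[OF subgroup_lower_central])
    qed
  qed
qed

lemma short_powers_inv:
  assumes j: "1 \<le> j" and x: "x \<in> lower_central G j" and sx: "short_powers j x"
  shows "short_powers j (inv x)"
proof -
  interpret L: comm_group "layer j" by (rule comm_group_layer[OF j])
  have xc: "x \<in> carrier G" using x by (rule lower_central_carrier)
  obtain C where C: "C \<ge> 0" "\<And>R m. \<lbrakk>R \<ge> 1; \<bar>m\<bar> \<le> int R ^ j\<rbrakk> \<Longrightarrow>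
     \<exists>g\<in>lower_central G j. layer_class j g = layer_class j x [^]\<^bsub>layer j\<^esub> m \<and> len g \<le> C * real R"
    using sx unfolding short_powers_def by blast
  have "layer_class j (inv x) = layer_class j (x [^] (- 1 :: int))" using xc by (simp add: int_pow_neg)
  then have "layer_class j (inv x) [^]\<^bsub>layer j\<^esub> m = layer_class j x [^]\<^bsub>layer j\<^esub> (- m)" for m :: int
    using x by (simp add: layer_class_int_pow L.int_pow_pow)
  then show ?thesis
    unfolding short_powers_def using C(1) C(2)[of _ "- _"] by (intro exI[of _ C]) simp
qed

text \<open>
Write the exponent as \<open>m = a * R + b\<close> with \<open>|a| \<le> R ^ j\<close> and \<open>0 \<le> b < R\<close>. By bilinearity, the \<open>m\<close>-th
power of \<open>[h, k]\<close> is the product of \<open>[h ^ R, k ^ a]\<close> and \<open>[h ^ b, k]\<close> modulo the next term, and \<open>k ^ a\<close> may be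
replaced by a short representative of its class.
\<close>

lemma short_powers_commutator:
  assumes j: "1 \<le> j" and h: "h \<in> carrier G" and k: "k \<in> lower_central G j" and sk: "short_powers j k"
  shows "short_powers (Suc j) (commutator h k)"
proof -
  interpret L: comm_group "layer (Suc j)" by (rule comm_group_layer) simp
  have kc: "k \<in> carrier G" using k by (rule lower_central_carrier)
  obtain C where C: "C \<ge> 0" "\<And>R m. \<lbrakk>R \<ge> 1; \<bar>m\<bar> \<le> int R ^ j\<rbrakk> \<Longrightarrow>
     \<exists>g\<in>lower_central G j. layer_class j g = layer_class j k [^]\<^bsub>layer j\<^esub> m \<and> len g \<le> C * real R"
    using sk unfolding short_powers_def by blast
  let ?q = "layer_class (Suc j) (commutator h k)"
  have comm_in: "commutator h' k' \<in> lower_central G (Suc j)" if "h' \<in> carrier G" "k' \<in> lower_central G j" for h' k'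
    using that j by (auto intro: commutator_in_lower_central)
  have left: "layer_class (Suc j) (commutator (h [^] (a::int)) k') =
      layer_class (Suc j) (commutator h k') [^]\<^bsub>layer (Suc j)\<^esub> a" if "k' \<in> lower_central G j" for a k'
    using group_hom.hom_int_pow[OF group_hom_commutator_left[OF j that] h] .
  have right: "layer_class (Suc j) (commutator h (k [^] (a::int))) = ?q [^]\<^bsub>layer (Suc j)\<^esub> a" for a
    using group_hom.hom_int_pow[OF group_hom_commutator_right[OF j h], of k a] k
      int_pow_consistent[OF subgroup_lower_central k] by simp
  show ?thesis
    unfolding short_powers_def
  proof (intro exI[of _ "4 * len h + 2 * C + 2 * len k"] conjI allI impI)
    show "0 \<le> 4 * len h + 2 * C + 2 * len k" using C h kc by (simp add: len_nonneg)
    fix R :: nat and m :: int assume R: "1 \<le> R" and m: "\<bar>m\<bar> \<le> int R ^ Suc j"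
    define a where "a = m div int R"
    define b where "b = m mod int R"
    have b: "0 \<le> b" "b < int R" using R by (auto simp: b_def)
    have mab: "m = int R * a + b" by (simp add: a_def b_def)
    have "a \<le> (int R * int R ^ j) div int R" using m R unfolding a_def by (intro zdiv_mono1) auto
    moreover have "(int R * - (int R ^ j)) div int R \<le> a"
      using m R unfolding a_def by (intro zdiv_mono1) auto
    moreover have cancel: "(int R * x) div int R = x" for x
      using R by (intro nonzero_mult_div_cancel_left) simp
    ultimately have "\<bar>a\<bar> \<le> int R ^ j"
      using cancel[of "int R ^ j"] cancel[of "- (int R ^ j)"] by linarith
    then obtain k' where k': "k' \<in> lower_central G j" "layer_class j k' = layer_class j k [^]\<^bsub>layer j\<^esub> a" "len k' \<le> C * real R"
      using C(2)[OF R] by blast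
    have kpow: "k [^] a \<in> lower_central G j" using k by (rule subgroup_int_pow_closed[OF subgroup_lower_central])
    have k'c: "k' \<in> carrier G" using k' by (auto intro: lower_central_carrier)
    let ?g = "commutator (h [^] int R) k' \<otimes> commutator (h [^] b) k"
    have hb: "h [^] int R \<in> carrier G" "h [^] b \<in> carrier G" using h by auto
    have "layer_class (Suc j) (commutator (h [^] int R) k') = layer_class (Suc j) (commutator (h [^] int R) (k [^] a))"
      using k' k by (intro commutator_class_cong[OF j hb(1) k'(1) kpow]) (simp add: layer_class_int_pow)
    also have "\<dots> = ?q [^]\<^bsub>layer (Suc j)\<^esub> (a * int R)"
      using left[OF kpow, of "int R"] right[of a] comm_in[OF h k] by (simp add: L.int_pow_pow)
    finally have 1: "layer_class (Suc j) (commutator (h [^] int R) k') = ?q [^]\<^bsub>layer (Suc j)\<^esub> (a * int R)" .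
    have 2: "layer_class (Suc j) ?g = ?q [^]\<^bsub>layer (Suc j)\<^esub> m"
    proof -
      have "layer_class (Suc j) ?g = ?q [^]\<^bsub>layer (Suc j)\<^esub> (a * int R) \<otimes>\<^bsub>layer (Suc j)\<^esub> ?q [^]\<^bsub>layer (Suc j)\<^esub> b"
        using 1 left[OF k, of b] comm_in[OF hb(1) k'(1)] comm_in[OF hb(2) k] by (simp only: layer_class_mult)
      also have "\<dots> = ?q [^]\<^bsub>layer (Suc j)\<^esub> (a * int R + b)"
        using comm_in[OF h k] by (simp add: L.int_pow_mult)
      also have "a * int R + b = m" by (simp add: mab mult.commute)
      finally show ?thesis .
    qed
    have "len ?g \<le> len (commutator (h [^] int R) k') + len (commutator (h [^] b) k)"
      using hb kc k'c by (intro len_mult) auto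
    also have "\<dots> \<le> (2 * len (h [^] int R) + 2 * len k') + (2 * len (h [^] b) + 2 * len k)"
      using hb kc k'c by (intro add_mono len_commutator_le)
    also have "\<dots> \<le> (2 * (real R * len h) + 2 * (C * real R)) + (2 * (real R * len h) + 2 * (real R * len k))"
    proof (intro add_mono mult_left_mono)
      show "len (h [^] int R) \<le> real R * len h" using len_int_pow_le[OF h, of "int R"] by simp
      have "len (h [^] b) \<le> real_of_int \<bar>b\<bar> * len h" by (rule len_int_pow_le[OF h])
      also have "\<dots> \<le> real R * len h" using b len_nonneg[OF h] by (intro mult_right_mono) auto
      finally show "len (h [^] b) \<le> real R * len h" .
      show "len k \<le> real R * len k" using R len_nonneg[OF kc] mult_right_mono[of 1 "real R" "len k"] by simp
    qed (use k' in auto)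
    also have "\<dots> = (4 * len h + 2 * C + 2 * len k) * real R" by (simp add: algebra_simps)
    finally have 3: "len ?g \<le> (4 * len h + 2 * C + 2 * len k) * real R" .
    have 4: "?g \<in> lower_central G (Suc j)"
      using comm_in[OF hb(1) k'(1)] comm_in[OF hb(2) k] by (rule subgroup.m_closed[OF subgroup_lower_central])
    show "\<exists>g\<in>lower_central G (Suc j). layer_class (Suc j) g = ?q [^]\<^bsub>layer (Suc j)\<^esub> m \<and>
        len g \<le> (4 * len h + 2 * C + 2 * len k) * real R"
      using 2 3 4 by (intro bexI[of _ ?g] conjI)
  qed
qed

lemma short_powers_lower_central:
  assumes j: "1 \<le> j" and x: "x \<in> lower_central G j"
  shows "short_powers j x"
  using j x
proof (induction j arbitrary: x rule: dec_induct)
  case base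
  then have x: "x \<in> carrier G" by simp
  show ?case
    unfolding short_powers_def
  proof (intro exI[of _ "len x"] conjI allI impI)
    show "0 \<le> len x" using x by (rule len_nonneg)
    fix R :: nat and m :: int assume R: "1 \<le> R" "\<bar>m\<bar> \<le> int R ^ 1"
    have "real_of_int \<bar>m\<bar> \<le> real R" using R by simp
    then have "len (x [^] m) \<le> len x * real R"
      using len_int_pow_le[OF x, of m] mult_right_mono[of "real_of_int \<bar>m\<bar>" "real R" "len x"] len_nonneg[OF x]
      by (simp add: mult.commute)
    then show "\<exists>g\<in>lower_central G 1. layer_class 1 g = layer_class 1 x [^]\<^bsub>layer 1\<^esub> m \<and> len g \<le> len x * real R"
      using x by (intro bexI[of _ "x [^] m"]) (auto simp: layer_class_int_pow)
  qed
next
  case (step j)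
  let ?C = "{commutator h k | h k. h \<in> carrier G \<and> k \<in> lower_central G j}"
  have C: "c \<in> lower_central G (Suc j)" "short_powers (Suc j) c" if "c \<in> ?C" for c
    using that step.hyps step.IH by (auto intro: commutator_in_lower_central short_powers_commutator)
  have "x \<in> generate G ?C" using step.prems step.hyps by (simp add: lower_central_Suc)
  then have "x \<in> lower_central G (Suc j) \<and> short_powers (Suc j) x"
  proof (induction rule: generate.induct)
    case one
    have "short_powers (Suc j) \<one>"
      unfolding short_powers_def
    proof (intro exI[of _ 0] conjI allI impI)
      fix R :: nat and m :: int
      show "\<exists>g\<in>lower_central G (Suc j). layer_class (Suc j) g = layer_class (Suc j) \<one> [^]\<^bsub>layer (Suc j)\<^esub> m \<and> len g \<le> 0 * real R"
        by (intro bexI[of _ \<one>]) 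
           (auto simp: len_one group.int_pow_one[OF group_layer] subgroup.one_closed[OF subgroup_lower_central])
    qed simp
    then show ?case by (simp add: subgroup.one_closed[OF subgroup_lower_central])
  next
    case (incl c)
    then show ?case using C by simp
  next
    case (inv c)
    then show ?case using C short_powers_inv[of "Suc j" c] by (simp add: subgroup.m_inv_closed[OF subgroup_lower_central])
  next
    case (eng c d)
    then show ?case using short_powers_mult[of "Suc j" c d] by (simp add: subgroup.m_closed[OF subgroup_lower_central])
  qed
  then show ?case by simp
qed

text \<open>Independence makes the combinations of \<open>B\<close> with coefficients below \<open>T\<close> distinct, and each is represented by a
product of representatives of the powers involved.\<close>

lemma layer_representatives:
  assumes j: "1 \<le> j" and B: "finite B" "B \<subseteq> carrier (layer j)" "int_independent (layer j) B"
    and reps: "\<And>b a. \<lbrakk>b \<in> B; a < T b\<rbrakk> \<Longrightarrow>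
        \<exists>g\<in>lower_central G j. layer_class j g = b [^]\<^bsub>layer j\<^esub> int a \<and> len g \<le> \<rho> b"
  shows "\<exists>Z. finite Z \<and> Z \<subseteq> lower_central G j \<and> inj_on (layer_class j) Z \<and> card Z = (\<Prod>b\<in>B. T b) \<and>
           (\<forall>z\<in>Z. len z \<le> (\<Sum>b\<in>B. \<rho> b))"
proof -
  interpret L: comm_group "layer j" by (rule comm_group_layer[OF j])
  let ?P = "PiE B (\<lambda>b. {..<T b})"
  have "\<exists>g\<in>lower_central G j. layer_class j g = L.int_comb B' (\<lambda>b. int (c b)) \<and> len g \<le> (\<Sum>b\<in>B'. \<rho> b)"
    if c: "\<And>b. b \<in> B \<Longrightarrow> c b < T b" and B': "B' \<subseteq> B" for c B'
  proof -
    have "finite B'" using B' B(1) by (rule finite_subset)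
    then show ?thesis using B'
    proof (induction B' rule: finite_induct)
      case empty
      show ?case
        by (intro bexI[of _ \<one>]) (auto simp: len_one subgroup.one_closed[OF subgroup_lower_central])
    next
      case (insert b B')
      then obtain g where g: "g \<in> lower_central G j" "layer_class j g = L.int_comb B' (\<lambda>b. int (c b))" "len g \<le> (\<Sum>b\<in>B'. \<rho> b)"
        by auto
      obtain h where h: "h \<in> lower_central G j" "layer_class j h = b [^]\<^bsub>layer j\<^esub> int (c b)" "len h \<le> \<rho> b"
        using reps[of b "c b"] c insert by auto
      have "layer_class j (h \<otimes> g) = L.int_comb (insert b B') (\<lambda>b. int (c b))"
        using g h insert B by (subst L.int_comb_insert) (auto simp: layer_class_mult)
      moreover have "len (h \<otimes> g) \<le> len h + len g" using g h by (intro len_mult lower_central_carrier)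
      then have "len (h \<otimes> g) \<le> (\<Sum>b\<in>insert b B'. \<rho> b)" using g h insert by simp
      moreover have "h \<otimes> g \<in> lower_central G j" using g h by (simp add: subgroup.m_closed[OF subgroup_lower_central])
      ultimately show ?case by (intro bexI[of _ "h \<otimes> g"] conjI)
    qed
  qed
  then have "\<forall>c\<in>?P. \<exists>g. g \<in> lower_central G j \<and> layer_class j g = L.int_comb B (\<lambda>b. int (c b)) \<and> len g \<le> (\<Sum>b\<in>B. \<rho> b)"
    by (metis PiE_mem lessThan_iff order_refl)
  then obtain z where z: "\<And>c. c \<in> ?P \<Longrightarrow> z c \<in> lower_central G j"
     "\<And>c. c \<in> ?P \<Longrightarrow> layer_class j (z c) = L.int_comb B (\<lambda>b. int (c b))"
     "\<And>c. c \<in> ?P \<Longrightarrow> len (z c) \<le> (\<Sum>b\<in>B. \<rho> b)" by metis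
  have inj: "c = d" if cd: "c \<in> ?P" "d \<in> ?P" "layer_class j (z c) = layer_class j (z d)" for c d
    using cd(1,2)
  proof (rule PiE_ext)
    fix b assume b: "b \<in> B"
    have "int (c b) = int (d b)"
      using L.int_comb_inj[OF B(2,3) _ b] cd z(2) by metis
    then show "c b = d b" by simp
  qed
  show ?thesis
  proof (intro exI[of _ "z ` ?P"] conjI)
    show "finite (z ` ?P)" using B by (intro finite_imageI finite_PiE) auto
    show "inj_on (layer_class j) (z ` ?P)" using inj by (intro inj_onI) auto
    have "inj_on z ?P" using inj by (intro inj_onI) auto
    then show "card (z ` ?P) = (\<Prod>b\<in>B. T b)" using B by (simp add: card_image card_PiE)
  qed (use z in auto)
qed

text \<open>In a product of representatives taken in increasing order of the layers, the first factor can be read off from its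
class in the first layer, then the second factor, and so on; hence the cardinalities multiply.\<close>

lemma multiply_layers:
  assumes i: "1 \<le> i" "i \<le> N"
    and Z: "\<And>j. j \<in> {1..<N} \<Longrightarrow> finite (Z j) \<and> Z j \<subseteq> lower_central G j \<and> inj_on (layer_class j) (Z j) \<and>
        (\<forall>z\<in>Z j. len z \<le> \<rho> j)"
  shows "\<exists>A. finite A \<and> A \<subseteq> lower_central G i \<and> card A = (\<Prod>j\<in>{i..<N}. card (Z j)) \<and>
           (\<forall>g\<in>A. len g \<le> (\<Sum>j\<in>{i..<N}. \<rho> j))"
  using i(2,1)
proof (induction i rule: inc_induct)
  case base
  show ?case
    by (rule exI[of _ "{\<one>}"]) (simp add: len_one subgroup.one_closed[OF subgroup_lower_central])
next
  case (step i)
  then obtain A where A: "finite A" "A \<subseteq> lower_central G (Suc i)" "card A = (\<Prod>j\<in>{Suc i..<N}. card (Z j))"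
    "\<forall>g\<in>A. len g \<le> (\<Sum>j\<in>{Suc i..<N}. \<rho> j)" by auto
  have Zi: "finite (Z i)" "Z i \<subseteq> lower_central G i" "inj_on (layer_class i) (Z i)" "\<forall>z\<in>Z i. len z \<le> \<rho> i"
    using Z[of i] step by auto
  have A_i: "a \<in> lower_central G i" if "a \<in> A" for a
    using that A lower_central_Suc_subset[of i] by blast
  have range: "{i..<N} = insert i {Suc i..<N}" using step by auto
  let ?m = "\<lambda>(z, a). z \<otimes> a"
  have inj: "inj_on ?m (Z i \<times> A)"
  proof (rule inj_onI, clarify)
    fix z a z' a' assume *: "z \<in> Z i" "a \<in> A" "z' \<in> Z i" "a' \<in> A" "z \<otimes> a = z' \<otimes> a'"
    have zi: "z \<in> lower_central G i" "z' \<in> lower_central G i" using * Zi by auto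
    have one: "layer_class i b = \<one>\<^bsub>layer i\<^esub>" if "b \<in> A" for b
      using that A by (subst layer_class_eq_one_iff) (auto intro: lower_central_carrier)
    have "layer_class i (z \<otimes> b) = layer_class i z" if "b \<in> A" "z \<in> lower_central G i" for z b
    proof -
      interpret L: group "layer i" by (rule group_layer)
      show ?thesis using that one[OF that(1)] A_i[OF that(1)] by (simp add: layer_class_mult)
    qed
    then have "layer_class i z = layer_class i z'" using * zi by metis
    then have "z = z'" using Zi(3) * by (auto dest: inj_onD)
    moreover have "a = a'"
      using *(5) zi A_i[OF *(2)] A_i[OF *(4)] \<open>z = z'\<close> by (simp add: lower_central_carrier)
    ultimately show "z = z' \<and> a = a'" by simp
  qed
  show ?case
  proof (intro exI[of _ "?m ` (Z i \<times> A)"] conjI ballI)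
    show "finite (?m ` (Z i \<times> A))" using Zi A by simp
    show "?m ` (Z i \<times> A) \<subseteq> lower_central G i"
      using Zi A_i by (auto intro!: subgroup.m_closed[OF subgroup_lower_central])
    show "card (?m ` (Z i \<times> A)) = (\<Prod>j\<in>{i..<N}. card (Z j))"
      using inj by (simp add: card_image card_cartesian_product A(3) range)
    fix g assume "g \<in> ?m ` (Z i \<times> A)"
    then obtain z a where g: "z \<in> Z i" "a \<in> A" "g = z \<otimes> a" by auto
    have "len g \<le> len z + len a"
      unfolding g(3) using g A_i Zi by (intro len_mult) (auto intro: lower_central_carrier)
    also have "\<dots> \<le> \<rho> i + (\<Sum>j\<in>{Suc i..<N}. \<rho> j)" using g A Zi by (intro add_mono) auto
    finally show "len g \<le> (\<Sum>j\<in>{i..<N}. \<rho> j)" by (simp add: range)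
  qed
qed

end

text \<open>The layers beyond the nilpotency class are generated by the empty set.\<close>

lemma (in group) torsion_free_rank_trivial_layer:
  assumes "1 \<le> j" and "lower_central G j = {\<one>}"
  shows "torsion_free_rank (layer j) = 0"
proof -
  interpret L: comm_group "layer j" using assms(1) by (rule comm_group_layer)
  have gen: "carrier (layer j) = generate (layer j) {}"
    using assms by (simp add: carrier_layer L.generate_empty)
  obtain B where "finite B" "B \<subseteq> carrier (layer j)" "int_independent (layer j) B" "card B = torsion_free_rank (layer j)"
    using L.ex_maximal_independent(1)[OF _ _ gen] by auto
  then show ?thesis using L.card_independent_le[OF _ _ gen, of B] by simp
qed

lemma (in group) homogeneous_dim_eq_sum:
  assumes N: "1 \<le> N" "lower_central G N = {\<one>}"
  shows "homogeneous_dim G = (\<Sum>j\<in>{1..<N}. j * torsion_free_rank (layer j))"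
proof -
  have "torsion_free_rank (layer j) = 0" if "N \<le> j" for j
  proof (rule torsion_free_rank_trivial_layer)
    show "lower_central G j = {\<one>}"
      using lower_central_antimono[OF that] N(2) subgroup.one_closed[OF subgroup_lower_central, of j] by auto
  qed (use that N in simp)
  then have "j < N" if "torsion_free_rank (layer j) \<noteq> 0" for j
    using that not_less by blast
  then have sub: "{j. 1 \<le> j \<and> torsion_free_rank (layer j) \<noteq> 0} \<subseteq> {1..<N}" by auto
  show ?thesis
    unfolding homogeneous_dim_def by (rule sum.mono_neutral_left) (use sub in auto)
qed

context group_length
begin

text \<open>The sets of representatives have \<open>R ^ (j * r\<^sub>j)\<close> elements in layer \<open>j\<close>, where \<open>r\<^sub>j\<close> is the rank, and
\<open>K\<close> times as many in layer \<open>l\<close>, where a power of \<open>s\<close> is taken as one of the independent elements and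
contributes \<open>K * R ^ l\<close> instead of \<open>R ^ l\<close> coefficients. The constant \<open>C\<close> must be independent of \<open>K\<close>, hence the
order of the quantifiers in the assumption on \<open>s\<close>.\<close>

lemma volume_lower_bound:
  assumes S: "finite S" "S \<subseteq> carrier G" "generate G S = carrier G"
    and N: "1 \<le> N" "lower_central G N = {\<one>}"
    and s: "s \<in> carrier G" and l: "1 \<le> l"
    and M: "1 \<le> M" "s [^] (M::nat) \<in> lower_central G l"
    and deep: "\<And>m::nat. 1 \<le> m \<Longrightarrow> s [^] m \<notin> lower_central G (Suc l)"
    and C0: "0 \<le> C0"
    and fast: "\<And>K::real. \<exists>R0. \<forall>R\<ge>R0. \<forall>m::nat. real m \<le> K * real R ^ l \<longrightarrow> len (s [^] m) \<le> C0 * real R"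
  shows "\<exists>C>0. \<forall>K>0. \<exists>R0. \<forall>R\<ge>R0. \<exists>A. finite A \<and> A \<subseteq> carrier G \<and>
          K * real R ^ homogeneous_dim G \<le> real (card A) \<and> (\<forall>g\<in>A. len g \<le> C * real R)"
proof -
  let ?r = "\<lambda>j. torsion_free_rank (layer j)"
  define x where "x = layer_class l (s [^] M)"
  have lN: "l < N"
  proof (rule ccontr)
    assume "\<not> l < N"
    then have "s [^] M \<in> lower_central G N" using M lower_central_antimono[of N l] by auto
    then have "s [^] M = \<one>" using N by simp
    then show False using deep[OF M(1)] by (simp add: subgroup.one_closed[OF subgroup_lower_central])
  qed
  interpret Ll: comm_group "layer l" by (rule comm_group_layer[OF l])
  have x_in: "x \<in> carrier (layer l)" using M by (simp add: x_def)
  have x_pow: "x [^]\<^bsub>layer l\<^esub> int a = layer_class l (s [^] (M * a))" for a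
    using layer_class_int_pow[OF M(2), of "int a"] s by (simp add: x_def int_pow_int nat_pow_pow)
  have x_pos: "x [^]\<^bsub>layer l\<^esub> int a \<noteq> \<one>\<^bsub>layer l\<^esub>" if "1 \<le> a" for a
  proof -
    have "1 \<le> M * a" using M that by simp
    then show ?thesis using deep[of "M * a"] s by (simp only: x_pow layer_class_eq_one_iff nat_pow_closed not_False_eq_True)
  qed
  have x_inf: "m = 0" if m: "x [^]\<^bsub>layer l\<^esub> m = \<one>\<^bsub>layer l\<^esub>" for m :: int
  proof (rule ccontr)
    assume "m \<noteq> 0"
    have "x [^]\<^bsub>layer l\<^esub> \<bar>m\<bar> = \<one>\<^bsub>layer l\<^esub>"
      using m x_in by (cases "m \<ge> 0") (auto simp: Ll.int_pow_neg)
    moreover have "1 \<le> nat \<bar>m\<bar>" using \<open>m \<noteq> 0\<close> by linarith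
    ultimately show False using x_pos[of "nat \<bar>m\<bar>"] by simp
  qed
  have "\<exists>B. finite B \<and> B \<subseteq> carrier (layer j) \<and> int_independent (layer j) B \<and> card B = ?r j \<and> (j = l \<longrightarrow> x \<in> B)"
    if j: "1 \<le> j" for j
  proof -
    interpret L: comm_group "layer j" by (rule comm_group_layer[OF j])
    obtain F where F: "finite F" "F \<subseteq> lower_central G j" "carrier (layer j) = generate (layer j) (layer_class j ` F)"
      using layer_finitely_generated[OF S j] by blast
    have F': "finite (layer_class j ` F)" "layer_class j ` F \<subseteq> carrier (layer j)"
      using F(1,2) layer_class_closed by blast+
    show ?thesis
    proof (cases "j = l")
      case True
      have "\<exists>B. finite B \<and> B \<subseteq> carrier (layer j) \<and> int_independent (layer j) B \<and> card B = ?r j \<and> x \<in> B"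
        by (rule L.ex_maximal_independent_containing[OF F' F(3)]) (use True x_in x_inf in auto)
      then show ?thesis using True by simp
    next
      case False
      then show ?thesis using L.ex_maximal_independent(1)[OF F' F(3)] by simp
    qed
  qed
  then obtain B where B: "\<And>j. 1 \<le> j \<Longrightarrow> finite (B j)" "\<And>j. 1 \<le> j \<Longrightarrow> B j \<subseteq> carrier (layer j)"
    "\<And>j. 1 \<le> j \<Longrightarrow> int_independent (layer j) (B j)" "\<And>j. 1 \<le> j \<Longrightarrow> card (B j) = ?r j" "x \<in> B l"
    using l by metis
  have "\<exists>C\<ge>0. \<forall>(R::nat)\<ge>1. \<forall>a::nat. a < R ^ j \<longrightarrow>
      (\<exists>g\<in>lower_central G j. layer_class j g = b [^]\<^bsub>layer j\<^esub> int a \<and> len g \<le> C * real R)"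
    if j: "1 \<le> j" and b: "b \<in> B j" for j b
  proof -
    obtain y where y: "y \<in> lower_central G j" "b = layer_class j y"
      using B(2)[OF j] b by (auto simp: carrier_layer)
    obtain C where C: "C \<ge> 0" "\<And>R m. \<lbrakk>R \<ge> 1; \<bar>m\<bar> \<le> int R ^ j\<rbrakk> \<Longrightarrow>
     \<exists>g\<in>lower_central G j. layer_class j g = layer_class j y [^]\<^bsub>layer j\<^esub> m \<and> len g \<le> C * real R"
      using short_powers_lower_central[OF j y(1)] unfolding short_powers_def by blast
    show ?thesis
    proof (intro exI[of _ C] conjI allI impI C(1))
      fix R a :: nat assume "1 \<le> R" "a < R ^ j"
      then show "\<exists>g\<in>lower_central G j. layer_class j g = b [^]\<^bsub>layer j\<^esub> int a \<and> len g \<le> C * real R"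
        unfolding y(2) by (intro C(2)) (auto simp flip: of_nat_power)
    qed
  qed
  then obtain c where c: "\<And>j b. \<lbrakk>1 \<le> j; b \<in> B j\<rbrakk> \<Longrightarrow> 0 \<le> c j b"
    "\<And>j b R a. \<lbrakk>1 \<le> j; b \<in> B j; 1 \<le> R; a < R ^ j\<rbrakk> \<Longrightarrow>
      \<exists>g\<in>lower_central G j. layer_class j g = b [^]\<^bsub>layer j\<^esub> int a \<and> len g \<le> c j b * real R"
    by metis
  define \<gamma> where "\<gamma> = (\<lambda>j b. if j = l \<and> b = x then C0 else c j b)"
  \<comment> \<open>The summand 1 makes \<open>C\<close> positive.\<close>
  define C where "C = (\<Sum>j\<in>{1..<N}. \<Sum>b\<in>B j. \<gamma> j b) + 1"
  have C: "C > 0" unfolding C_def using C0 c(1)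
    by (intro add_nonneg_pos sum_nonneg) (auto simp: \<gamma>_def)
  show ?thesis
  proof (intro exI[of _ C] conjI allI impI C)
    fix K :: real assume K: "K > 0"
    define k where "k = nat \<lceil>K\<rceil>"
    have k: "K \<le> real k" unfolding k_def by linarith
    obtain R1 where R1: "\<And>R m. \<lbrakk>R \<ge> R1; real m \<le> real (M * k) * real R ^ l\<rbrakk> \<Longrightarrow> len (s [^] m) \<le> C0 * real R"
      using fast[of "real (M * k)"] by blast
    show "\<exists>R0. \<forall>R\<ge>R0. \<exists>A. finite A \<and> A \<subseteq> carrier G \<and>
          K * real R ^ homogeneous_dim G \<le> real (card A) \<and> (\<forall>g\<in>A. len g \<le> C * real R)"
    proof (intro exI[of _ "max R1 1"] allI impI)
      fix R assume "max R1 1 \<le> R"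
      then have R: "R \<ge> R1" "R \<ge> 1" by auto
      define T where "T = (\<lambda>j b. if j = l \<and> b = x then k * R ^ l else R ^ j)"
      have reps: "\<exists>g\<in>lower_central G j. layer_class j g = b [^]\<^bsub>layer j\<^esub> int a \<and> len g \<le> \<gamma> j b * real R"
        if j: "1 \<le> j" and b: "b \<in> B j" and a: "a < T j b" for j b a
      proof (cases "j = l \<and> b = x")
        case True
        have "real (M * a) \<le> real (M * (k * R ^ l))" using a True by (intro of_nat_mono mult_le_mono2) (simp add: T_def)
        then have "len (s [^] (M * a)) \<le> C0 * real R" by (intro R1 R) (simp add: mult.assoc)
        moreover have "s [^] (M * a) \<in> lower_central G l"
          using subgroup_int_pow_closed[OF subgroup_lower_central M(2), of "int a"] s
          by (simp add: int_pow_int nat_pow_pow)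
        ultimately show ?thesis using True by (intro bexI[of _ "s [^] (M * a)"]) (auto simp: x_pow \<gamma>_def)
      next
        case False
        then have "\<gamma> j b = c j b" "T j b = R ^ j" by (auto simp: \<gamma>_def T_def)
        then show ?thesis using c(2)[OF j b R(2), of a] a by simp
      qed
      have "\<exists>Z. finite Z \<and> Z \<subseteq> lower_central G j \<and> inj_on (layer_class j) Z \<and> card Z = (\<Prod>b\<in>B j. T j b) \<and>
           (\<forall>z\<in>Z. len z \<le> (\<Sum>b\<in>B j. \<gamma> j b * real R))" if "1 \<le> j" for j
        by (rule layer_representatives[OF that B(1-3)[OF that] reps[OF that]])
      then obtain Z where Z: "\<And>j. 1 \<le> j \<Longrightarrow> finite (Z j) \<and> Z j \<subseteq> lower_central G j \<and> inj_on (layer_class j) (Z j) \<and>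
           (\<forall>z\<in>Z j. len z \<le> (\<Sum>b\<in>B j. \<gamma> j b * real R))"
        and card_Z: "\<And>j. 1 \<le> j \<Longrightarrow> card (Z j) = (\<Prod>b\<in>B j. T j b)" by metis
      obtain A where A: "finite A" "A \<subseteq> lower_central G 1" "card A = (\<Prod>j\<in>{1..<N}. card (Z j))"
        "\<And>g. g \<in> A \<Longrightarrow> len g \<le> (\<Sum>j\<in>{1..<N}. \<Sum>b\<in>B j. \<gamma> j b * real R)"
        using multiply_layers[OF order_refl N(1), of Z "\<lambda>j. \<Sum>b\<in>B j. \<gamma> j b * real R"] Z by auto
      have card_layer: "card (Z j) = (if j = l then k else 1) * R ^ (j * ?r j)" if j: "1 \<le> j" for j
      proof (cases "j = l")
        case True
        have "(\<Prod>b\<in>B l. T l b) = T l x * (\<Prod>b\<in>B l - {x}. T l b)"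
          using B l by (intro prod.remove) auto
        also have "(\<Prod>b\<in>B l - {x}. T l b) = (\<Prod>b\<in>B l - {x}. R ^ l)" by (rule prod.cong) (auto simp: T_def)
        also have "T l x * \<dots> = k * (R ^ l * (R ^ l) ^ card (B l - {x}))" by (simp add: T_def)
        also have "R ^ l * (R ^ l) ^ card (B l - {x}) = (R ^ l) ^ card (B l)"
          unfolding card_Suc_Diff1[OF B(1)[OF l] B(5), symmetric] by simp
        finally show ?thesis using card_Z[OF j] B(4)[OF l] True by (simp add: power_mult)
      next
        case False
        then have "(\<Prod>b\<in>B j. T j b) = (\<Prod>b\<in>B j. R ^ j)" by (intro prod.cong) (auto simp: T_def)
        then show ?thesis using card_Z[OF j] B(4)[OF j] False by (simp add: power_mult)
      qed
      have "card A = (\<Prod>j\<in>{1..<N}. (if j = l then k else 1) * R ^ (j * ?r j))"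
        unfolding A(3) by (rule prod.cong) (auto simp: card_layer)
      also have "\<dots> = (\<Prod>j\<in>{1..<N}. if j = l then k else 1) * R ^ homogeneous_dim G"
        by (simp add: prod.distrib power_sum homogeneous_dim_eq_sum[OF N])
      also have "(\<Prod>j\<in>{1..<N}. if j = l then k else 1) = k" using l lN by (simp add: prod.delta')
      finally have "K * real R ^ homogeneous_dim G \<le> real (card A)"
        using k by (simp add: mult_right_mono)
      moreover have "len g \<le> C * real R" if "g \<in> A" for g
      proof -
        have "len g \<le> (C - 1) * real R" using A(4)[OF that] by (simp add: C_def sum_distrib_right)
        also have "\<dots> \<le> C * real R" by (intro mult_right_mono) auto
        finally show ?thesis .
      qed
      ultimately show "\<exists>A. finite A \<and> A \<subseteq> carrier G \<and>
          K * real R ^ homogeneous_dim G \<le> real (card A) \<and> (\<forall>g\<in>A. len g \<le> C * real R)"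
        using A(1,2) by (intro exI[of _ A]) simp
    qed
  qed
qed

end

section \<open>The stable-like step distribution\<close>

lemma stable_weight_nonneg: "0 \<le> stable_weight \<alpha> m"
  by (simp add: stable_weight_def)

lemma stable_weight_uminus: "stable_weight \<alpha> (- m) = stable_weight \<alpha> m"
  by (auto simp: stable_weight_def)

lemma stable_weight_pos:
  assumes "m \<in> {0, 1}"
  shows "0 < stable_weight \<alpha> m"
  using assms by (auto simp: stable_weight_def)

lemma summable_stable_weight:
  assumes "0 < \<alpha>"
  shows "stable_weight \<alpha> summable_on UNIV"
proof (cases "\<alpha> = \<infinity>")
  case True
  have "stable_weight \<alpha> summable_on {- 1, 0, 1}" by simp
  moreover have "stable_weight \<alpha> summable_on {- 1, 0, 1} \<longleftrightarrow> stable_weight \<alpha> summable_on UNIV"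
    by (rule summable_on_cong_neutral) (auto simp: stable_weight_def True)
  ultimately show ?thesis by simp
next
  case False
  then obtain a where a: "\<alpha> = ereal a" "a > 0" using assms by (cases \<alpha>) auto
  have "summable (\<lambda>n. real (Suc n) powr (- a - 1))"
    using a by (subst summable_Suc_iff) (simp add: summable_real_powr_iff)
  then have nat: "(\<lambda>n. real (Suc n) powr (- a - 1)) summable_on UNIV"
    by (subst summable_on_UNIV_nonneg_real_iff) auto
  have w: "stable_weight \<alpha> \<circ> int = (\<lambda>n. real (Suc n) powr (- a - 1))"
      "stable_weight \<alpha> \<circ> (\<lambda>n. - int n) = (\<lambda>n. real (Suc n) powr (- a - 1))"
    using a by (auto simp: stable_weight_def fun_eq_iff)
  have "stable_weight \<alpha> summable_on range int"
    using nat w by (subst summable_on_reindex) auto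
  moreover have "stable_weight \<alpha> summable_on range (\<lambda>n. - int n)"
    using nat w by (subst summable_on_reindex) (auto simp: inj_on_def)
  ultimately have "stable_weight \<alpha> summable_on (range int \<union> range (\<lambda>n. - int n))"
    by (rule summable_on_union)
  moreover have "range int \<union> range (\<lambda>n. - int n) = UNIV"
    by (metis (no_types, lifting) UNIV_eq_I UnCI int_cases2 rangeI)
  ultimately show ?thesis by simp
qed

lemma infsum_stable_weight_pos:
  assumes "0 < \<alpha>"
  shows "0 < (\<Sum>\<^sub>\<infinity>m\<in>UNIV. stable_weight \<alpha> m)"
proof -
  have "(\<Sum>m\<in>{0}. stable_weight \<alpha> m) \<le> (\<Sum>\<^sub>\<infinity>m\<in>UNIV. stable_weight \<alpha> m)"
    by (rule finite_sum_le_infsum) (auto simp: summable_stable_weight assms stable_weight_nonneg)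
  then show ?thesis using stable_weight_pos[of 0 \<alpha>] by simp
qed

lemma stable_const_pos: "0 < \<alpha> \<Longrightarrow> 0 < stable_const \<alpha>"
  using infsum_stable_weight_pos by (simp add: stable_const_def)

context group
begin

text \<open>The contribution of one generator to the step distribution, before normalization.\<close>

abbreviation power_weight_sum :: "'a \<Rightarrow> ereal \<Rightarrow> 'a \<Rightarrow> real" where
  "power_weight_sum s \<alpha> g \<equiv> (\<Sum>\<^sub>\<infinity>m::int\<in>UNIV. stable_weight \<alpha> m * indicator {s [^] m} g)"

lemma summable_power_weight_sum:
  assumes "0 < \<alpha>"
  shows "(\<lambda>m. stable_weight \<alpha> m * indicator {s [^] (m::int)} g) summable_on UNIV"
  using summable_stable_weight[OF assms]
  by (rule summable_on_comparison_test) (auto simp: indicator_def stable_weight_nonneg)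

lemma power_weight_sum_ge:
  assumes "0 < \<alpha>"
  shows "stable_weight \<alpha> m \<le> power_weight_sum s \<alpha> (s [^] m)"
proof -
  let ?f = "\<lambda>j. stable_weight \<alpha> j * indicator {s [^] j} (s [^] m)"
  have "sum ?f {m} \<le> power_weight_sum s \<alpha> (s [^] m)"
    by (rule finite_sum_le_infsum[of ?f]) (auto simp: summable_power_weight_sum assms stable_weight_nonneg)
  then show ?thesis by simp
qed

lemma power_weight_sum_nonneg: "0 \<le> power_weight_sum s \<alpha> g"
  by (intro infsum_nonneg) (auto simp: stable_weight_nonneg)

lemma has_sum_power_weight_sum:
  assumes "0 < \<alpha>" and s: "s \<in> carrier G"
  shows "(power_weight_sum s \<alpha> has_sum (\<Sum>\<^sub>\<infinity>m\<in>UNIV. stable_weight \<alpha> m)) (carrier G)"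
proof -
  have inner: "((\<lambda>g. case (m, g) of (m, g) \<Rightarrow> stable_weight \<alpha> m * indicator {s [^] m} g) has_sum stable_weight \<alpha> m) (carrier G)"
    for m :: int
  proof -
    have "((\<lambda>g. stable_weight \<alpha> m * indicator {s [^] m} g) has_sum stable_weight \<alpha> m) {s [^] m}"
      by (rule has_sum_finiteI) auto
    moreover have "((\<lambda>g. stable_weight \<alpha> m * indicator {s [^] m} g) has_sum stable_weight \<alpha> m) {s [^] m} \<longleftrightarrow>
      ((\<lambda>g. stable_weight \<alpha> m * indicator {s [^] m} g) has_sum stable_weight \<alpha> m) (carrier G)"
      by (rule has_sum_cong_neutral) (use s in auto)
    ultimately show ?thesis by simp
  qed
  have "(\<lambda>(m, g). stable_weight \<alpha> m * indicator {s [^] m} g) summable_on UNIV \<times> carrier G"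
    by (rule summable_on_SigmaI[OF inner summable_stable_weight[OF assms(1)]]) (auto simp: stable_weight_nonneg)
  then have "((\<lambda>(m, g). stable_weight \<alpha> m * indicator {s [^] m} g) has_sum (\<Sum>\<^sub>\<infinity>m\<in>UNIV. stable_weight \<alpha> m)) (UNIV \<times> carrier G)"
    using summable_stable_weight[OF assms(1)] by (intro has_sum_SigmaI[OF inner]) auto
  from has_sum_swap[THEN iffD1, OF this]
  have "((\<lambda>(g, m). stable_weight \<alpha> m * indicator {s [^] m} g) has_sum (\<Sum>\<^sub>\<infinity>m\<in>UNIV. stable_weight \<alpha> m)) (carrier G \<times> UNIV)"
    by simp
  then show ?thesis
    by (rule has_sum_SigmaD) (simp add: summable_power_weight_sum assms)
qed

lemma power_weight_sum_inv:
  assumes s: "s \<in> carrier G" and g: "g \<in> carrier G"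
  shows "power_weight_sum s \<alpha> (inv g) = power_weight_sum s \<alpha> g"
proof -
  have "bij (uminus :: int \<Rightarrow> int)" by (rule bij_uminus)
  then have "power_weight_sum s \<alpha> (inv g) = (\<Sum>\<^sub>\<infinity>m::int\<in>UNIV. stable_weight \<alpha> (- m) * indicator {s [^] (- m)} (inv g))"
    by (rule infsum_reindex_bij_betw[symmetric])
  also have "\<dots> = power_weight_sum s \<alpha> g"
  proof (rule infsum_cong)
    fix m :: int
    have "inv g = s [^] (- m) \<longleftrightarrow> g = s [^] m"
      using s g by (simp only: int_pow_neg) (metis inv_inv int_pow_closed)
    then show "stable_weight \<alpha> (- m) * indicator {s [^] (- m)} (inv g) = stable_weight \<alpha> m * indicator {s [^] m} g"
      by (simp add: stable_weight_uminus indicator_def)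
  qed
  finally show ?thesis .
qed

context
  fixes k :: nat and s :: "nat \<Rightarrow> 'a" and \<alpha> :: "nat \<Rightarrow> ereal"
  assumes k: "1 \<le> k" and s: "s \<in> {1..k} \<rightarrow> carrier G" and \<alpha>: "\<And>i. i \<in> {1..k} \<Longrightarrow> 0 < \<alpha> i"
begin

lemma stable_walk_measure_ge:
  assumes i: "i \<in> {1..k}"
  shows "stable_const (\<alpha> i) / real k * stable_weight (\<alpha> i) m \<le> stable_walk_measure G k s \<alpha> (s i [^] m)"
proof -
  have "stable_const (\<alpha> i) * stable_weight (\<alpha> i) m \<le> stable_const (\<alpha> i) * power_weight_sum (s i) (\<alpha> i) (s i [^] m)"
    using stable_const_pos[OF \<alpha>[OF i]] power_weight_sum_ge[OF \<alpha>[OF i]] by (intro mult_left_mono) auto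
  also have "\<dots> \<le> (\<Sum>j=1..k. stable_const (\<alpha> j) * power_weight_sum (s j) (\<alpha> j) (s i [^] m))"
    using i by (intro member_le_sum) (auto intro!: mult_nonneg_nonneg power_weight_sum_nonneg less_imp_le[OF stable_const_pos] \<alpha>)
  finally show ?thesis
    unfolding stable_walk_measure_def using k by (simp add: divide_right_mono)
qed

lemma prob_density_stable_walk_measure: "prob_density G (stable_walk_measure G k s \<alpha>)"
  unfolding prob_density_def
proof (intro conjI ballI)
  fix g
  show "0 \<le> stable_walk_measure G k s \<alpha> g"
    unfolding stable_walk_measure_def
    by (intro mult_nonneg_nonneg sum_nonneg power_weight_sum_nonneg less_imp_le[OF stable_const_pos] \<alpha>) auto
next
  have "((\<lambda>g. \<Sum>i\<in>I. stable_const (\<alpha> i) * power_weight_sum (s i) (\<alpha> i) g) has_sum real (card I)) (carrier G)"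
    if "I \<subseteq> {1..k}" for I
  proof -
    have "finite I" using that by (rule finite_subset) simp
    then show ?thesis using that
    proof (induction I rule: finite_induct)
      case (insert i I)
      have i: "i \<in> {1..k}" using insert by simp
      have "((\<lambda>g. stable_const (\<alpha> i) * power_weight_sum (s i) (\<alpha> i) g) has_sum
          (stable_const (\<alpha> i) * (\<Sum>\<^sub>\<infinity>m\<in>UNIV. stable_weight (\<alpha> i) m))) (carrier G)"
        using s i by (intro has_sum_cmult_right has_sum_power_weight_sum \<alpha>) auto
      moreover have "stable_const (\<alpha> i) * (\<Sum>\<^sub>\<infinity>m\<in>UNIV. stable_weight (\<alpha> i) m) = 1"
        using infsum_stable_weight_pos[OF \<alpha>[OF i]] by (simp add: stable_const_def)
      ultimately have "((\<lambda>g. stable_const (\<alpha> i) * power_weight_sum (s i) (\<alpha> i) g +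
          (\<Sum>i\<in>I. stable_const (\<alpha> i) * power_weight_sum (s i) (\<alpha> i) g)) has_sum (1 + real (card I))) (carrier G)"
        using insert by (intro has_sum_add) auto
      then show ?case using insert by simp
    qed simp
  qed
  then have "((\<lambda>g. \<Sum>i=1..k. stable_const (\<alpha> i) * power_weight_sum (s i) (\<alpha> i) g) has_sum real (card {1..k})) (carrier G)"
    by blast
  then have "((\<lambda>g. 1 / real k * (\<Sum>i=1..k. stable_const (\<alpha> i) * power_weight_sum (s i) (\<alpha> i) g)) has_sum
      (1 / real k * real (card {1..k}))) (carrier G)"
    by (rule has_sum_cmult_right)
  then show "(stable_walk_measure G k s \<alpha> has_sum 1) (carrier G)"
    unfolding stable_walk_measure_def using k by simp
qed

lemma stable_walk_measure_inv:
  assumes "g \<in> carrier G"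
  shows "stable_walk_measure G k s \<alpha> (inv g) = stable_walk_measure G k s \<alpha> g"
  unfolding stable_walk_measure_def using s assms
  by (intro arg_cong2[where f = "(*)"] sum.cong refl power_weight_sum_inv) auto

lemma stable_walk_measure_pos:
  assumes i: "i \<in> {1..k}" and m: "m \<in> {0, 1}"
  shows "0 < stable_walk_measure G k s \<alpha> (s i [^] (m::int))"
proof -
  have "0 < stable_const (\<alpha> i) / real k * stable_weight (\<alpha> i) m"
    using stable_const_pos[OF \<alpha>[OF i]] stable_weight_pos[OF m] k by simp
  then show ?thesis using stable_walk_measure_ge[OF i, of m] by simp
qed

lemma irreducible_stable_walk:
  assumes gen: "generate G (s ` {1..k}) = carrier G"
  shows "irreducible_walk G (stable_walk_measure G k s \<alpha>)"
proof unfold_locales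
  show "prob_density G (stable_walk_measure G k s \<alpha>)" by (rule prob_density_stable_walk_measure)
  show "stable_walk_measure G k s \<alpha> (inv x) = stable_walk_measure G k s \<alpha> x" if "x \<in> carrier G" for x
    using that by (rule stable_walk_measure_inv)
  show "0 < stable_walk_measure G k s \<alpha> \<one>"
    using stable_walk_measure_pos[of 1 0] k by simp
  have "s ` {1..k} \<subseteq> {g \<in> carrier G. 0 < stable_walk_measure G k s \<alpha> g}"
  proof
    fix x assume "x \<in> s ` {1..k}"
    then obtain i where i: "i \<in> {1..k}" "x = s i" by auto
    then have "s i \<in> carrier G" using s by auto
    then show "x \<in> {g \<in> carrier G. 0 < stable_walk_measure G k s \<alpha> g}"
      using stable_walk_measure_pos[OF i(1), of 1] i(2) by (simp add: int_pow_1)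
  qed
  then have "carrier G \<subseteq> generate G {g \<in> carrier G. 0 < stable_walk_measure G k s \<alpha> g}"
    using mono_generate[of "s ` {1..k}"] gen by simp
  moreover have "generate G {g \<in> carrier G. 0 < stable_walk_measure G k s \<alpha> g} \<subseteq> carrier G"
    by (rule generate_incl) auto
  ultimately show "generate G {g \<in> carrier G. 0 < stable_walk_measure G k s \<alpha> g} = carrier G" by blast
qed

end

text \<open>A finite supremum of extended natural numbers is a maximum.\<close>

lemma commutator_length_enatD:
  assumes g: "g \<in> carrier G" and l: "commutator_length G g = enat l"
  shows "1 \<le> l" and "\<exists>m::nat. 1 \<le> m \<and> g [^] m \<in> lower_central G l"
    and "1 \<le> (m::nat) \<Longrightarrow> g [^] m \<notin> lower_central G (Suc l)"
proof -
  let ?A = "{enat l | l. 1 \<le> l \<and> (\<exists>m::nat. 1 \<le> m \<and> g [^] m \<in> lower_central G l)}"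
  have sup: "Sup ?A = enat l" using l by (simp add: commutator_length_def)
  show deep: "g [^] m \<notin> lower_central G (Suc l)" if "1 \<le> m" for m :: nat
  proof
    assume "g [^] m \<in> lower_central G (Suc l)"
    then have "enat (Suc l) \<in> ?A" using that by auto
    then have "enat (Suc l) \<le> Sup ?A" by (rule Sup_upper)
    then show False using sup by simp
  qed
  have "g [^] (1::nat) \<in> lower_central G 1" using g by simp
  then have ne: "?A \<noteq> {}" by blast
  have fin: "finite ?A"
  proof (rule ccontr)
    assume "infinite ?A"
    then have "Sup ?A = \<infinity>" using ne by (simp only: Sup_enat_def if_False)
    then show False using sup by simp
  qed
  have "Sup ?A = Max ?A" using ne fin by (simp only: Sup_enat_def if_False if_True)
  then have "enat l \<in> ?A" using Max_in[OF fin ne] sup by (simp only:)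
  then show "1 \<le> l" "\<exists>m::nat. 1 \<le> m \<and> g [^] m \<in> lower_central G l" by auto
qed

end

theorem theorem1p13:
  fixes G :: "('a, 'b) monoid_scheme" (structure)
    and k :: nat
    and s :: "nat \<Rightarrow> 'a"
    and \<alpha> :: "nat \<Rightarrow> ereal"
  assumes "nilpotent_group G"
    and "s \<in> {1..k} \<rightarrow> carrier G"
    and "generate G (s ` {1..k}) = carrier G"
    and "\<And>i. i \<in> {1..k} \<Longrightarrow> 0 < \<alpha> i"
    and "\<exists>i\<in>{1..k}. (\<alpha> i, commutator_length G (s i)) = (2, 1) \<or>
                     \<alpha> i * ereal_of_enat (commutator_length G (s i)) < 2"
  shows "(\<lambda>n. real n powr (real (homogeneous_dim G) / 2) *
               convolution_power G (stable_walk_measure G k s \<alpha>) n \<one>) \<longlonglongrightarrow> 0"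
proof -
  let ?\<mu> = "stable_walk_measure G k s \<alpha>"
  interpret nilpotent_group G by fact
  obtain i where i: "i \<in> {1..k}" and
    heavy: "(\<alpha> i, commutator_length G (s i)) = (2, 1) \<or> \<alpha> i * ereal_of_enat (commutator_length G (s i)) < 2"
    using assms(5) by blast
  have k: "1 \<le> k" using i by simp
  have si: "s i \<in> carrier G" using assms(2) i by auto
  interpret W: irreducible_walk G ?\<mu>
    by (rule irreducible_stable_walk[OF k assms(2,4,3)])
  have \<alpha>i: "0 < \<alpha> i" using assms(4) i by simp
  \<comment> \<open>An infinite commutator length or \<open>\<alpha> i = \<infinity>\<close> would make the product infinite.\<close>
  obtain l where l: "commutator_length G (s i) = enat l"
  proof (cases "commutator_length G (s i)")
    case infinity
    then show ?thesis using heavy \<alpha>i by (cases "\<alpha> i") auto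
  qed
  note cl = commutator_length_enatD[OF si l]
  obtain a where a: "\<alpha> i = ereal a" "0 < a"
    using \<alpha>i heavy cl(1) unfolding l by (cases "\<alpha> i") auto
  have dichotomy: "(a = 2 \<and> l = 1) \<or> a * real l < 2"
    using heavy unfolding l a by (auto simp: one_enat_def numeral_eq_ereal)
  define c where "c = stable_const (\<alpha> i) / real k"
  have c: "0 < c" using stable_const_pos[OF \<alpha>i] k by (simp add: c_def)
  have tail: "c * (1 + real m) powr (- a - 1) \<le> ?\<mu> (s i [^] m)" for m :: nat
  proof -
    have "c * stable_weight (\<alpha> i) (int m) \<le> ?\<mu> (s i [^] int m)"
      unfolding c_def by (rule stable_walk_measure_ge[OF k assms(2) _ i]) (rule assms(4))
    then show ?thesis by (simp add: stable_weight_def a int_pow_int)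
  qed
  have inj: "inj (\<lambda>m::nat. s i [^] m)"
  proof (rule linorder_injI)
    fix m n :: nat assume "m < n"
    show "s i [^] m \<noteq> s i [^] n"
    proof
      assume eq: "s i [^] m = s i [^] n"
      have "s i [^] n = s i [^] m \<otimes> s i [^] (n - m)" using si \<open>m < n\<close> by (simp add: nat_pow_mult)
      then have "s i [^] (n - m) = \<one>" using si eq by (metis l_cancel_one' nat_pow_closed)
      moreover have "1 \<le> n - m" using \<open>m < n\<close> by linarith
      ultimately show False using cl(3)[of "n - m"] subgroup.one_closed[OF subgroup_lower_central] by simp
    qed
  qed
  obtain M :: nat where M: "1 \<le> M" "s i [^] M \<in> lower_central G l" using cl(2) by blast
  obtain N where N: "1 \<le> N" "lower_central G N = {\<one>}" using nilpotent by blast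
  have "\<exists>C>0. \<forall>K>0. \<exists>R0. \<forall>R\<ge>R0. \<exists>A. finite A \<and> A \<subseteq> carrier G \<and>
          K * real R ^ homogeneous_dim G \<le> real (card A) \<and> (\<forall>g\<in>A. W.len g \<le> C * real R)"
  proof (rule W.volume_lower_bound[OF _ _ assms(3) N si cl(1) M cl(3)])
    show "finite (s ` {1..k})" "s ` {1..k} \<subseteq> carrier G" using assms(2) by auto
    show "0 \<le> sqrt (4 / (c * ?\<mu> \<one>))" using c W.lazy by simp
    show "\<exists>R0. \<forall>R\<ge>R0. \<forall>m::nat. real m \<le> K * real R ^ l \<longrightarrow>
        W.len (s i [^] m) \<le> sqrt (4 / (c * ?\<mu> \<one>)) * real R" for K :: real
      by (rule W.superlinear_powers[OF si inj c tail a(2) dichotomy])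
  qed
  then obtain C where "C > 0" and "\<And>K. K > 0 \<Longrightarrow> \<exists>R0. \<forall>R\<ge>R0. \<exists>A. finite A \<and> A \<subseteq> carrier G \<and>
          K * real R ^ homogeneous_dim G \<le> real (card A) \<and> (\<forall>g\<in>A. W.len g \<le> C * real R)"
    by blast
  then show ?thesis by (intro W.walk_one_tendsto_0 W.return_prob_tendsto_0)
qed

end
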